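(* Let $X$ be a compact tropical space and let $\phi\in C^1(X;\mathcal W_1)/B^1_{div}(X;\mathcal W_1)$ be the element defined on a singular $1$-simplex $\tau:[0,1]\to X$ by $\phi(\tau)=y_{\tau(1)}-y_{\tau(0)}\in W(\tau)$. Then $\delta\phi=0$; thus $\phi$ defines a class in $H^1(X;\mathcal W_1)$.
   Context: **Tropical spaces.** $\mathbb T=[-\infty,\infty)$. For $I\subset\{1,\dots,N\}$ put $\mathbb T_I^\circ=\{y\in\mathbb T^N: y_i=-\infty \iff i\in I\}\cong\mathbb R^{N-|I|}$ and let $\mathbb T_I$ be its closure. An integral affine map $\mathbb T^N\dashrightarrow\mathbb T^M$ is the extension by continuity (wherever it exists) of an affine map $\mathbb R^N\to\mathbb R^M$ with integral linear part. A convex polyhedral domain $D\subset\mathbb T^N$ is a finite intersection of half-spaces $\{jx\le a\}$, $j\in\mathbb Z^N$, $a\in\mathbb R$; its mobile faces $E$ are its intersections with boundaries $\{jx=a\}$ of some defining half-spaces; the sets $E\cap\mathbb T_I$ are its faces, of sedentarity $|I|$ and refined sedentarity $I$, and $E$ is the parent of $E\cap \mathbb T_I$. $D$ is regular at infinity if each $D\cap\mathbb T_I^\circ$ is empty or a polyhedral domain of dimension $\dim D-|I|$. An $n$-dimensional polyhedral complex $Y\subset\mathbb T^N$ is a finite union of $n$-dimensional domains (facets) such that the intersection of any collection of facets is a face of each of them; all complexes are assumed regular at infinity. $Y$ is balanced if for each $(n-1)$-dimensional mobile face $E$ with adjacent facets $D_1,\dots,D_l$ one has $\sum_k\epsilon_k=0$,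 where $\epsilon_k$ is the outward primitive integer vector of the image of $D_k$ in the quotient of $\mathbb R^N$ by the linear space parallel to $E\cap\mathbb R^N$. A tropical space is a topological space $X$ with a finite cover by open sets $U_\alpha$ and open embeddings (charts) $\phi_\alpha:U_\alpha\to Y_\alpha\subset\mathbb T^{N_\alpha}$ into balanced polyhedral complexes, with overlap maps induced by integral affine maps, such that (finite type) if $x_j\in U_\alpha$ and $\phi_\alpha(x_j)\to y\in\mathbb T^{N_\alpha}$ then either $x_j$ converges in $X$ or some coordinate is $-\infty$ at $y$ but finite on $\phi_\alpha(U_\alpha)$. **Wave tangent spaces, strata, waves.** For $y$ of refined sedentarity $I$ in $Y\subset\mathbb T^N$, let $\Sigma(y)\subset\mathbb T_I^\circ\cong\mathbb R^{N-|I|}$ be the cone of vectors $u$ with $y+\epsilon u\in Y\cap\mathbb T_I^\circ$ for small $\epsilon>0$, and $W'(y)$ the intersection of all maximal linear subspaces contained in $\Sigma(y)$. $W(y)=W'(y_m)$ for $y_m$ in the relative interior of the parent of the face containing $y$ in its relative interior. The divisorial vectors at $y$ are the primitive vectors $-\mathbf e_i$, $i\in I$ (pointing towards $-\infty$); they span $W^{div}(y)\subset W(y)$. Combinatorial strata are classes of points connected by paths along which $\dim W$ and the sedentarity are constant; within a chart $W$ is canonically constant along a stratum, and if the stratum of $x$ lies in the closure of that of $y$ there is an inclusion $\pi:W(x)\to W(y)$. $C^r(X;\mathcal W_1)$ consists of functions assigning to each singular $r$-simplex $\sigma$ (with image in a single chart and with each relatively open face mapping into a single stratum) an element of $W(\sigma):=W$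 of the stratum of $\mathrm{int}(\sigma)$, compatibly with overlap maps; $\delta$ is the usual coboundary followed by the maps $\pi$; $H^r(X;\mathcal W_1)$ is the cohomology. **The element $\phi$.** $C^0_{div}(X;\mathcal W_1)\subset C^0(X;\mathcal W_1)$ is the subspace of $0$-cochains with value at each $x$ in $W^{div}(x)$, and $B^1_{div}(X;\mathcal W_1)=\delta C^0_{div}(X;\mathcal W_1)$. For each $x\in X$ of positive sedentarity choose a nearby mobile (sedentarity $0$) point $y_x$ in the relative interior of the parent face, projecting to $x$ along the divisorial directions; for $x$ mobile put $y_x=x$. The difference $y_{\tau(1)}-y_{\tau(0)}$ is taken in a chart containing $\tau$ and is a vector in $W(\tau)$. Different choices of the $y_x$ change $\phi$ by an element of $B^1_{div}(X;\mathcal W_1)$.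
   Formalization: The formal theorem assumes explicitly that, within a chart, W is constant along each stratum and W(x) lies in W(y) when x is a limit of y's stratum; the text asserts this as a fact, but it can fail for compact tropical spaces, and then the cochains C^r and the coboundary are not defined. *)

theory Defs
  imports "HOL-Analysis.Analysis" "HOL-Homology.Simplices"
begin

section \<open>Tropical affine space\<close>

text \<open>
  For a finite set \<open>J\<close> of coordinates, \<open>tspace J\<close> is a copy of the tropical affine space of
  dimension \<open>card J\<close>, inside the vectors over the extended reals indexed by \<open>'n\<close>: the coordinates
  outside \<open>J\<close> are put to \<open>0\<close>. In this way the finitely many charts of one space can have
  different dimensions. A point of refined sedentarity \<open>I\<close> is identified with a real vector that
  vanishes on \<open>I\<close>, so the stratum of sedentarity \<open>I\<close> is a coordinate subspace of \<open>real ^ 'n\<close>.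
\<close>

definition tspace :: "'n::finite set \<Rightarrow> (ereal ^ 'n) set" where
  "tspace J = {y. \<forall>i. y $ i \<noteq> \<infinity> \<and> (i \<notin> J \<longrightarrow> y $ i = 0)}"

definition sed :: "ereal ^ 'n::finite \<Rightarrow> 'n set" where
  "sed y = {i. y $ i = -\<infinity>}"

definition tpoint :: "'n::finite set \<Rightarrow> real ^ 'n \<Rightarrow> ereal ^ 'n" where
  "tpoint I v = (\<chi> i. if i \<in> I then -\<infinity> else ereal (v $ i))"

text \<open>Coordinates equal to \<open>-\<infinity>\<close> become \<open>0\<close> here.\<close>

definition realvec :: "ereal ^ 'n::finite \<Rightarrow> real ^ 'n" where
  "realvec y = (\<chi> i. real_of_ereal (y $ i))"

definition slice :: "'n::finite set \<Rightarrow> (ereal ^ 'n) set \<Rightarrow> (real ^ 'n) set" where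
  "slice I D = {v. (\<forall>i\<in>I. v $ i = 0) \<and> tpoint I v \<in> D}"

abbreviation fin_part :: "(ereal ^ 'n::finite) set \<Rightarrow> (real ^ 'n) set" where
  "fin_part \<equiv> slice {}"

definition integral_vec :: "real ^ 'n::finite \<Rightarrow> bool" where
  "integral_vec v \<longleftrightarrow> (\<forall>i. v $ i \<in> \<int>)"

text \<open>\<open>z\<close> is the value at \<open>y\<close> of the extension by continuity of \<open>v \<mapsto> A v + b\<close> to infinite points.\<close>

definition affine_extension_at ::
    "real ^ 'n ^ 'n \<Rightarrow> real ^ 'n \<Rightarrow> ereal ^ 'n \<Rightarrow> ereal ^ 'n::finite \<Rightarrow> bool" where
  "affine_extension_at A b y z \<longleftrightarrow>
     ((\<lambda>v. tpoint {} (A *v v + b)) \<longlongrightarrow> z) (filtercomap (tpoint {}) (nhds y))"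


section \<open>Polyhedral complexes\<close>

text \<open>
  Half-spaces and their boundaries are closures of the real ones. Where the linear form \<open>j\<close> extends
  by continuity, this gives the points with \<open>j x \<le> a\<close> and \<open>j x = a\<close> for the extended form; the
  points where \<open>j x\<close> is of the shape \<open>\<infinity> - \<infinity>\<close> belong to both.
\<close>

definition half_space :: "real ^ 'n::finite \<Rightarrow> real \<Rightarrow> (ereal ^ 'n) set" where
  "half_space j a = closure (tpoint {} ` {v. j \<bullet> v \<le> a})"

definition half_space_boundary :: "real ^ 'n::finite \<Rightarrow> real \<Rightarrow> (ereal ^ 'n) set" where
  "half_space_boundary j a = closure (tpoint {} ` {v. j \<bullet> v = a})"

text \<open>A domain comes with its defining half-spaces, since its mobile faces refer to them.\<close>

type_synonym 'n half_spaces = "((real ^ 'n) \<times> real) set"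

definition tdomain :: "'n::finite set \<Rightarrow> 'n half_spaces \<Rightarrow> (ereal ^ 'n) set" where
  "tdomain J H = tspace J \<inter> (\<Inter>(j, a)\<in>H. half_space j a)"

definition mobile_faces :: "'n::finite set \<Rightarrow> 'n half_spaces \<Rightarrow> (ereal ^ 'n) set set" where
  "mobile_faces J H =
     {E. E \<noteq> {} \<and> (\<exists>S\<subseteq>H. E = tdomain J H \<inter> (\<Inter>(j, a)\<in>S. half_space_boundary j a))}"

definition domain_faces :: "'n::finite set \<Rightarrow> 'n half_spaces \<Rightarrow> (ereal ^ 'n) set set" where
  "domain_faces J H =
     {F. F \<noteq> {} \<and> (\<exists>E\<in>mobile_faces J H. \<exists>I. F = E \<inter> {y. \<forall>i\<in>I. y $ i = -\<infinity>})}"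

text \<open>The dimension is taken on the real part; a domain that is regular at infinity has no larger
  pieces at infinity.\<close>

definition tdim :: "(ereal ^ 'n::finite) set \<Rightarrow> int" where
  "tdim D = aff_dim (fin_part D)"

definition regular_at_infinity :: "(ereal ^ 'n::finite) set \<Rightarrow> bool" where
  "regular_at_infinity D \<longleftrightarrow>
     (\<forall>I. slice I D = {} \<or> aff_dim (slice I D) = tdim D - int (card I))"

definition complex_support :: "'n::finite set \<Rightarrow> 'n half_spaces set \<Rightarrow> (ereal ^ 'n) set" where
  "complex_support J Y = (\<Union>H\<in>Y. tdomain J H)"

definition complex_mobile_faces ::
    "'n::finite set \<Rightarrow> 'n half_spaces set \<Rightarrow> (ereal ^ 'n) set set" where
  "complex_mobile_faces J Y = (\<Union>H\<in>Y. mobile_faces J H)"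

text \<open>Regularity at infinity is required of every mobile face, the facets being among these.\<close>

definition polyhedral_complex ::
    "'n::finite set \<Rightarrow> nat \<Rightarrow> 'n half_spaces set \<Rightarrow> bool" where
  "polyhedral_complex J n Y \<longleftrightarrow>
     finite Y \<and>
     (\<forall>H\<in>Y. finite H \<and> (\<forall>(j, a)\<in>H. integral_vec j) \<and> tdim (tdomain J H) = int n) \<and>
     (\<forall>E\<in>complex_mobile_faces J Y. regular_at_infinity E) \<and>
     (\<forall>C\<subseteq>Y. C \<noteq> {} \<longrightarrow>
        (\<Inter>H\<in>C. tdomain J H) = {} \<or>
        (\<forall>H\<in>C. (\<Inter>H'\<in>C. tdomain J H') \<in> domain_faces J H))"

definition parallel_space :: "(ereal ^ 'n::finite) set \<Rightarrow> (real ^ 'n) set" where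
  "parallel_space E = span {u - v | u v. u \<in> fin_part E \<and> v \<in> fin_part E}"

text \<open>\<open>u\<close> is an integer vector whose class in the quotient by \<open>parallel_space E\<close> is primitive and
  spans the ray that is the image of \<open>D\<close>.\<close>

definition outward_primitive ::
    "(ereal ^ 'n::finite) set \<Rightarrow> (ereal ^ 'n) set \<Rightarrow> real ^ 'n \<Rightarrow> bool" where
  "outward_primitive E D u \<longleftrightarrow>
     integral_vec u \<and> u \<notin> parallel_space E \<and>
     (\<forall>(m::nat) w. integral_vec w \<and> u - real m *\<^sub>R w \<in> parallel_space E \<longrightarrow> m = 1) \<and>
     (\<exists>p\<in>fin_part E. \<exists>q\<in>fin_part D. \<exists>t>0. q - p - t *\<^sub>R u \<in> parallel_space E)"

definition balanced :: "'n::finite set \<Rightarrow> nat \<Rightarrow> 'n half_spaces set \<Rightarrow> bool" where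
  "balanced J n Y \<longleftrightarrow>
     (\<forall>E\<in>complex_mobile_faces J Y. tdim E = int n - 1 \<longrightarrow>
        (\<exists>u. (\<forall>D\<in>tdomain J ` Y. E \<subseteq> D \<longrightarrow> outward_primitive E D (u D)) \<and>
             (\<Sum>D\<in>{D \<in> tdomain J ` Y. E \<subseteq> D}. u D) \<in> parallel_space E))"


section \<open>Tropical spaces\<close>

record ('a, 'n) tchart =
  chart_dom :: "'a set"
  chart_map :: "'a \<Rightarrow> ereal ^ 'n"
  chart_coords :: "'n set"
  chart_complex :: "'n half_spaces set"

definition chart_support :: "('a, 'n::finite) tchart \<Rightarrow> (ereal ^ 'n) set" where
  "chart_support c = complex_support (chart_coords c) (chart_complex c)"

definition tropical_chart :: "'a topology \<Rightarrow> ('a, 'n::finite) tchart \<Rightarrow> bool" where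
  "tropical_chart X c \<longleftrightarrow>
     openin X (chart_dom c) \<and>
     (\<exists>n. polyhedral_complex (chart_coords c) n (chart_complex c) \<and>
          balanced (chart_coords c) n (chart_complex c)) \<and>
     embedding_map (subtopology X (chart_dom c)) euclidean (chart_map c) \<and>
     openin (top_of_set (chart_support c)) (chart_map c ` chart_dom c)"

definition finite_type :: "'a topology \<Rightarrow> ('a, 'n::finite) tchart \<Rightarrow> bool" where
  "finite_type X c \<longleftrightarrow>
     (\<forall>x y. range x \<subseteq> chart_dom c \<and> y \<in> tspace (chart_coords c) \<and>
            (\<lambda>k. chart_map c (x k)) \<longlonglongrightarrow> y \<longrightarrow>
        (\<exists>l. limitin X x l sequentially) \<or>
        (\<exists>i. y $ i = -\<infinity> \<and> (\<forall>z\<in>chart_dom c. chart_map c z $ i \<noteq> -\<infinity>)))"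

definition induces_overlap ::
    "('a, 'n::finite) tchart \<Rightarrow> ('a, 'n) tchart \<Rightarrow> real ^ 'n ^ 'n \<Rightarrow> real ^ 'n \<Rightarrow> bool" where
  "induces_overlap c c' A b \<longleftrightarrow>
     (\<forall>i k. A $ i $ k \<in> \<int>) \<and>
     (\<forall>x \<in> chart_dom c \<inter> chart_dom c'. affine_extension_at A b (chart_map c x) (chart_map c' x))"

definition tropical_space :: "'a topology \<Rightarrow> ('a, 'n::finite) tchart set \<Rightarrow> bool" where
  "tropical_space X \<A> \<longleftrightarrow>
     finite \<A> \<and>
     topspace X = (\<Union>c\<in>\<A>. chart_dom c) \<and>
     (\<forall>c\<in>\<A>. tropical_chart X c \<and> finite_type X c) \<and>
     (\<forall>c\<in>\<A>. \<forall>c'\<in>\<A>. \<exists>A b. induces_overlap c c' A b)"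


section \<open>Wave tangent spaces and strata\<close>

definition tangent_cone :: "(ereal ^ 'n::finite) set \<Rightarrow> ereal ^ 'n \<Rightarrow> (real ^ 'n) set" where
  "tangent_cone Z y =
     {u. (\<forall>i\<in>sed y. u $ i = 0) \<and>
         (\<exists>e0>0. \<forall>e. 0 < e \<and> e < e0 \<longrightarrow> tpoint (sed y) (realvec y + e *\<^sub>R u) \<in> Z)}"

definition maximal_subspace :: "(real ^ 'n::finite) set \<Rightarrow> (real ^ 'n) set \<Rightarrow> bool" where
  "maximal_subspace S L \<longleftrightarrow>
     subspace L \<and> L \<subseteq> S \<and> (\<forall>L'. subspace L' \<and> L' \<subseteq> S \<and> L \<subseteq> L' \<longrightarrow> L' = L)"

definition wave_pre :: "(ereal ^ 'n::finite) set \<Rightarrow> ereal ^ 'n \<Rightarrow> (real ^ 'n) set" where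
  "wave_pre Z y = \<Inter>{L. maximal_subspace (tangent_cone Z y) L}"

text \<open>\<open>E\<close> is the parent of the face having \<open>y\<close> in its relative interior.\<close>

definition is_parent ::
    "'n::finite set \<Rightarrow> 'n half_spaces set \<Rightarrow> ereal ^ 'n \<Rightarrow> (ereal ^ 'n) set \<Rightarrow> bool" where
  "is_parent J Y y E \<longleftrightarrow>
     E \<in> complex_mobile_faces J Y \<and> y \<in> E \<and> realvec y \<in> rel_interior (slice (sed y) E)"

definition wave_tangent ::
    "'n::finite set \<Rightarrow> 'n half_spaces set \<Rightarrow> ereal ^ 'n \<Rightarrow> (real ^ 'n) set" where
  "wave_tangent J Y y =
     wave_pre (complex_support J Y)
       (tpoint {} (SOME v. \<exists>E. is_parent J Y y E \<and> v \<in> rel_interior (fin_part E)))"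

definition wave_div :: "ereal ^ 'n::finite \<Rightarrow> (real ^ 'n) set" where
  "wave_div y = span ((\<lambda>i. - axis i 1) ` sed y)"

definition chart_wave :: "('a, 'n::finite) tchart \<Rightarrow> 'a \<Rightarrow> (real ^ 'n) set" where
  "chart_wave c x = wave_tangent (chart_coords c) (chart_complex c) (chart_map c x)"

definition same_stratum :: "'a topology \<Rightarrow> ('a, 'n::finite) tchart set \<Rightarrow> 'a \<Rightarrow> 'a \<Rightarrow> bool" where
  "same_stratum X \<A> x y \<longleftrightarrow>
     (\<exists>\<gamma> s d. pathin X \<gamma> \<and> \<gamma> 0 = x \<and> \<gamma> 1 = y \<and>
        (\<forall>t\<in>{0..1}. \<forall>c\<in>\<A>. \<gamma> t \<in> chart_dom c \<longrightarrow>
           card (sed (chart_map c (\<gamma> t))) = s \<and> dim (chart_wave c (\<gamma> t)) = d))"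

text \<open>
  Existence of the inclusions \<open>\<pi>\<close> from \<open>W(x)\<close> to \<open>W(y)\<close>, when the stratum of \<open>x\<close> lies in the
  closure of that of \<open>y\<close>. It is stated along a path in a chart, because one stratum can reach \<open>x\<close>
  along several branches. Applied in both directions within one stratum it says that \<open>W\<close> is
  constant along paths of the stratum in a chart; thus it is what makes \<open>W\<close> of a simplex and the
  coboundary meaningful. It does not follow from balancing: at the origin of the union of the plane
  \<open>{(s, -s)}\<close> and the product of two tropical lines in \<open>R\<^sup>2 \<times> R\<^sup>2\<close>, the plane is the only
  maximal linear subspace of the tangent cone, so the plane and the open facets of the product
  lie in one stratum.
\<close>

definition wave_inclusions :: "'a topology \<Rightarrow> ('a, 'n::finite) tchart set \<Rightarrow> bool" where
  "wave_inclusions X \<A> \<longleftrightarrow>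
     (\<forall>c\<in>\<A>. \<forall>\<gamma>. pathin (subtopology X (chart_dom c)) \<gamma> \<and>
        (\<forall>s\<in>{0<..1}. \<forall>t\<in>{0<..1}. same_stratum X \<A> (\<gamma> s) (\<gamma> t)) \<longrightarrow>
        chart_wave c (\<gamma> 0) \<subseteq> chart_wave c (\<gamma> 1))"


section \<open>Cohomology with wave coefficients\<close>

definition open_face :: "nat \<Rightarrow> nat set \<Rightarrow> (nat \<Rightarrow> real) set" where
  "open_face r K = {t \<in> standard_simplex r. {i. t i \<noteq> 0} = K}"

definition simplex_in_chart ::
    "'a topology \<Rightarrow> ('a, 'n::finite) tchart set \<Rightarrow> nat \<Rightarrow> ((nat \<Rightarrow> real) \<Rightarrow> 'a)
      \<Rightarrow> ('a, 'n) tchart \<Rightarrow> bool" where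
  "simplex_in_chart X \<A> r \<sigma> c \<longleftrightarrow>
     c \<in> \<A> \<and> singular_simplex r X \<sigma> \<and> \<sigma> ` standard_simplex r \<subseteq> chart_dom c \<and>
     (\<forall>K. \<forall>s\<in>open_face r K. \<forall>t\<in>open_face r K. same_stratum X \<A> (\<sigma> s) (\<sigma> t))"

text \<open>\<open>W\<close> of a simplex is read off at its barycentre, a point of its interior.\<close>

definition simplex_wave ::
    "nat \<Rightarrow> ((nat \<Rightarrow> real) \<Rightarrow> 'a) \<Rightarrow> ('a, 'n::finite) tchart \<Rightarrow> (real ^ 'n) set" where
  "simplex_wave r \<sigma> c = chart_wave c (\<sigma> (\<lambda>i. if i \<le> r then 1 / real (Suc r) else 0))"

text \<open>
  The value of a cochain on a simplex is given by its representative in each chart containing the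
  simplex; representatives correspond under the linear parts of the overlap maps. Elsewhere
  a cochain is \<open>0\<close>, so that equality of cochains is equality of functions.
\<close>

type_synonym ('a, 'n) wave_cochain =
  "((nat \<Rightarrow> real) \<Rightarrow> 'a) \<Rightarrow> ('a, 'n) tchart \<Rightarrow> real ^ 'n"

definition wave_cochains ::
    "'a topology \<Rightarrow> ('a, 'n::finite) tchart set \<Rightarrow> nat \<Rightarrow> ('a, 'n) wave_cochain set" where
  "wave_cochains X \<A> r =
     {f. (\<forall>\<sigma> c. simplex_in_chart X \<A> r \<sigma> c \<longrightarrow> f \<sigma> c \<in> simplex_wave r \<sigma> c) \<and>
         (\<forall>\<sigma> c. \<not> simplex_in_chart X \<A> r \<sigma> c \<longrightarrow> f \<sigma> c = 0) \<and>
         (\<forall>\<sigma> c c' A b.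
            simplex_in_chart X \<A> r \<sigma> c \<and> simplex_in_chart X \<A> r \<sigma> c' \<and>
            induces_overlap c c' A b \<longrightarrow> A *v f \<sigma> c = f \<sigma> c')}"

text \<open>In a chart the maps \<open>\<pi>\<close> are inclusions of subspaces of \<open>real ^ 'n\<close>.\<close>

definition wave_coboundary ::
    "'a topology \<Rightarrow> ('a, 'n::finite) tchart set \<Rightarrow> nat
      \<Rightarrow> ('a, 'n) wave_cochain \<Rightarrow> ('a, 'n) wave_cochain" where
  "wave_coboundary X \<A> r f = (\<lambda>\<sigma> c.
     if simplex_in_chart X \<A> (Suc r) \<sigma> c
     then \<Sum>k\<le>Suc r. (-1) ^ k *\<^sub>R f (singular_face (Suc r) k \<sigma>) c else 0)"

definition wave_cocycles ::
    "'a topology \<Rightarrow> ('a, 'n::finite) tchart set \<Rightarrow> nat \<Rightarrow> ('a, 'n) wave_cochain set" where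
  "wave_cocycles X \<A> r = {f \<in> wave_cochains X \<A> r. wave_coboundary X \<A> r f = (\<lambda>\<sigma> c. 0)}"

definition wave_coboundaries ::
    "'a topology \<Rightarrow> ('a, 'n::finite) tchart set \<Rightarrow> nat \<Rightarrow> ('a, 'n) wave_cochain set" where
  "wave_coboundaries X \<A> r =
     (case r of 0 \<Rightarrow> {\<lambda>\<sigma> c. 0} | Suc q \<Rightarrow> wave_coboundary X \<A> q ` wave_cochains X \<A> q)"

definition cochain_coset ::
    "('a, 'n::finite) wave_cochain \<Rightarrow> ('a, 'n) wave_cochain set \<Rightarrow> ('a, 'n) wave_cochain set" where
  "cochain_coset f B = {\<lambda>\<sigma> c. f \<sigma> c + b \<sigma> c | b. b \<in> B}"

definition wave_cohomology ::
    "'a topology \<Rightarrow> ('a, 'n::finite) tchart set \<Rightarrow> nat \<Rightarrow> ('a, 'n) wave_cochain set set" where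
  "wave_cohomology X \<A> r =
     {cochain_coset f (wave_coboundaries X \<A> r) | f. f \<in> wave_cocycles X \<A> r}"


section \<open>The eigenwave\<close>

definition simplex_vertex :: "nat \<Rightarrow> nat \<Rightarrow> real" where
  "simplex_vertex k = (\<lambda>i. if i = k then 1 else 0)"

definition div_cochains ::
    "'a topology \<Rightarrow> ('a, 'n::finite) tchart set \<Rightarrow> ('a, 'n) wave_cochain set" where
  "div_cochains X \<A> =
     {f \<in> wave_cochains X \<A> 0. \<forall>\<sigma> c. simplex_in_chart X \<A> 0 \<sigma> c \<longrightarrow>
        f \<sigma> c \<in> wave_div (chart_map c (\<sigma> (simplex_vertex 0)))}"

definition div_coboundaries ::
    "'a topology \<Rightarrow> ('a, 'n::finite) tchart set \<Rightarrow> ('a, 'n) wave_cochain set" where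
  "div_coboundaries X \<A> = wave_coboundary X \<A> 0 ` div_cochains X \<A>"

text \<open>A choice of mobile points \<open>y x\<close>. Nearness to \<open>x\<close> enters through the requirement that \<open>y x\<close>
  lies in all charts containing \<open>x\<close>, which makes differences in a chart meaningful.\<close>

definition mobile_choice ::
    "'a topology \<Rightarrow> ('a, 'n::finite) tchart set \<Rightarrow> ('a \<Rightarrow> 'a) \<Rightarrow> bool" where
  "mobile_choice X \<A> y \<longleftrightarrow>
     (\<forall>x\<in>topspace X. \<forall>c\<in>\<A>. x \<in> chart_dom c \<longrightarrow>
        y x \<in> chart_dom c \<and>
        sed (chart_map c (y x)) = {} \<and>
        (\<exists>E. is_parent (chart_coords c) (chart_complex c) (chart_map c x) E \<and>
             realvec (chart_map c (y x)) \<in> rel_interior (fin_part E)) \<and>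
        (\<forall>i. i \<notin> sed (chart_map c x) \<longrightarrow> chart_map c (y x) $ i = chart_map c x $ i) \<and>
        (sed (chart_map c x) = {} \<longrightarrow> y x = x))"

definition eigenwave_cochain ::
    "'a topology \<Rightarrow> ('a, 'n::finite) tchart set \<Rightarrow> ('a \<Rightarrow> 'a) \<Rightarrow> ('a, 'n) wave_cochain" where
  "eigenwave_cochain X \<A> y = (\<lambda>\<tau> c.
     if simplex_in_chart X \<A> 1 \<tau> c
     then realvec (chart_map c (y (\<tau> (simplex_vertex 1))))
        - realvec (chart_map c (y (\<tau> (simplex_vertex 0)))) else 0)"

text \<open>The class modulo divisorial coboundaries.\<close>

definition eigenwave ::
    "'a topology \<Rightarrow> ('a, 'n::finite) tchart set \<Rightarrow> ('a \<Rightarrow> 'a) \<Rightarrow> ('a, 'n) wave_cochain set" where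
  "eigenwave X \<A> y = cochain_coset (eigenwave_cochain X \<A> y) (div_coboundaries X \<A>)"

end

theory Submission
  imports Defs
begin

text \<open>
  Regularity at infinity forces the linear space parallel to a mobile face \<open>E\<close> to
  contain the divisorial directions at every point of \<open>E\<close>, and since every facet
  meeting the relative interior of \<open>E\<close> contains \<open>E\<close>, this space lies
  in the wave tangent space at each point with parent \<open>E\<close>. As there are finitely
  many faces, the points of a 1-simplex close to a given one lie only in faces through that
  point, so the mobile representatives \<open>y x\<close> are locally constant modulo the wave
  tangent space of the open simplex, hence constant. This puts \<open>\<phi>\<close> in the wave
  cochains; being a difference of vertex values, \<open>\<phi>\<close> is closed, and another
  choice of \<open>y\<close> moves the vertex values along divisorial directions.
\<close>

section \<open>Closures of convex sets at infinity\<close>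

text \<open>The definition of \<open>wave_tangent\<close> picks a point by \<open>SOME\<close>, and
  nothing below decides whether it belongs to the same parent as \<open>y x\<close>, or whether
  parents are unique. The proof therefore uses a single inclusion: the directions of whichever
  parent is selected lie in the wave tangent space. This suffices because displacements are shown to
  be parallel to that very face. A second obstacle is that the wave tangent space may change at the
  ends of a simplex. Local constancy is therefore measured in the space at the moving point, not at
  the fixed one, and the ends occur only as fixed points. Spaces at different interior points are
  compared through \<open>wave_inclusions\<close>, with the barycentre as common target.\<close>

definition coord_space :: "'n::finite set \<Rightarrow> (real ^ 'n) set" where
  "coord_space I = {v. \<forall>i. i \<notin> I \<longrightarrow> v $ i = 0}"

lemma subspace_coord_space: "subspace (coord_space I)"
  by (auto simp: subspace_def coord_space_def)

lemma dim_coord_space: "dim (coord_space I) = card I"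
  unfolding coord_space_def using dim_substandard_cart[of I, where 'a=real]
  by (simp add: dim_vec_eq)

lemma coord_space_eq_wave_div: "coord_space (sed y) = wave_div y"
proof
  show "wave_div y \<subseteq> coord_space (sed y)"
    unfolding wave_div_def
    by (rule span_minimal[OF _ subspace_coord_space]) (auto simp: coord_space_def axis_def)
  show "coord_space (sed y) \<subseteq> wave_div y"
  proof
    fix v :: "real ^ 'a" assume v: "v \<in> coord_space (sed y)"
    have "v = (\<Sum>i\<in>UNIV. v $ i *\<^sub>R axis i 1)"
      using basis_expansion[of v] by (simp add: scalar_mult_eq_scaleR)
    also have "\<dots> = (\<Sum>i\<in>sed y. (- v $ i) *\<^sub>R - axis i 1)"
      using v by (intro sum.mono_neutral_cong_right) (auto simp: coord_space_def)
    also have "\<dots> \<in> wave_div y"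
      unfolding wave_div_def by (intro span_sum span_scale span_base) auto
    finally show "v \<in> wave_div y" .
  qed
qed

section \<open>Points at infinity in real coordinates\<close>

lemma tpoint_nth [simp]: "tpoint I v $ i = (if i \<in> I then -\<infinity> else ereal (v $ i))"
  by (simp add: tpoint_def)

lemma sed_tpoint [simp]: "sed (tpoint I v) = I"
  by (auto simp: sed_def)

lemma realvec_tpoint: "(\<And>i. i \<in> I \<Longrightarrow> v $ i = 0) \<Longrightarrow> realvec (tpoint I v) = v"
  by (auto simp: realvec_def vec_eq_iff)

lemma realvec_tpoint_empty [simp]: "realvec (tpoint {} v) = v"
  by (rule realvec_tpoint) simp

text \<open>\<open>realvec\<close> sends both infinities to \<open>0\<close>; once \<infinity> is
  excluded, \<open>sed\<close> records all that was lost.\<close>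

lemma tpoint_sed_realvec:
  assumes "\<And>i. y $ i \<noteq> \<infinity>"
  shows "tpoint (sed y) (realvec y) = y"
  using assms by (auto simp: vec_eq_iff sed_def realvec_def ereal_real)

lemma realvec_in_slice:
  assumes "y \<in> D" "D \<subseteq> tspace J"
  shows "realvec y \<in> slice (sed y) D"
proof -
  have "tpoint (sed y) (realvec y) = y"
    using assms by (intro tpoint_sed_realvec) (auto simp: tspace_def)
  then show ?thesis
    using assms(1) by (auto simp: slice_def realvec_def sed_def)
qed

text \<open>Boxes with a side below \<open>M\<close> in the directions of \<open>I\<close> and an
  interval of radius \<open>e\<close> in the others form a neighbourhood base at
  \<open>tpoint I v\<close>. All later questions about closures at infinity become real inequalities
  through this criterion.\<close>

lemma tpoint_in_closure_iff:
  fixes C :: "(real ^ 'n::finite) set"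
  shows "tpoint I v \<in> closure (tpoint {} ` C) \<longleftrightarrow>
    (\<forall>e>0. \<forall>M. \<exists>w\<in>C. \<forall>i. if i \<in> I then w $ i < M else \<bar>w $ i - v $ i\<bar> < e)"
    (is "_ \<longleftrightarrow> ?R")
proof
  assume L: "tpoint I v \<in> closure (tpoint {} ` C)"
  show ?R
  proof (intro allI impI)
    fix e M :: real assume "e > 0"
    define B where "B = (\<lambda>i. if i \<in> I then {..<ereal M} else {ereal (v $ i - e)<..<ereal (v $ i + e)})"
    define U where "U = {z::ereal^'n. \<forall>i. z $ i \<in> B i}"
    have "open U"
      unfolding U_def by (intro open_vector_box) (auto simp: B_def)
    moreover have "tpoint I v \<in> U"
      using \<open>e > 0\<close> by (auto simp: U_def B_def)
    ultimately obtain w where w: "w \<in> C" "tpoint {} w \<in> U"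
      using L open_Int_closure_eq_empty[of U "tpoint {} ` C"] by blast
    have "\<forall>i. if i \<in> I then w $ i < M else \<bar>w $ i - v $ i\<bar> < e"
    proof
      fix i
      have "ereal (w $ i) \<in> B i" using w(2) by (simp add: U_def)
      then show "if i \<in> I then w $ i < M else \<bar>w $ i - v $ i\<bar> < e"
        by (auto simp: B_def)
    qed
    with w(1) show "\<exists>w\<in>C. \<forall>i. if i \<in> I then w $ i < M else \<bar>w $ i - v $ i\<bar> < e"
      by blast
  qed
next
  assume R: ?R
  \<comment> \<open>The bounds \<open>- real k\<close> and \<open>inverse (real (Suc k))\<close>
    tighten together, so the chosen points form a sequence converging to
    \<open>tpoint I v\<close>.\<close>
  have "\<forall>k. \<exists>w\<in>C. \<forall>i. if i \<in> I then w $ i < - real k else \<bar>w $ i - v $ i\<bar> < inverse (real (Suc k))"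
  proof
    fix k
    show "\<exists>w\<in>C. \<forall>i. if i \<in> I then w $ i < - real k else \<bar>w $ i - v $ i\<bar> < inverse (real (Suc k))"
      using R[rule_format, of "inverse (real (Suc k))" "- real k"] by simp
  qed
  then obtain w where w: "\<And>k. w k \<in> C"
      and wi: "\<And>k i. if i \<in> I then w k $ i < - real k else \<bar>w k $ i - v $ i\<bar> < inverse (real (Suc k))"
    by metis
  have "(\<lambda>k. tpoint {} (w k)) \<longlonglongrightarrow> tpoint I v"
  proof (rule vec_tendstoI)
    fix i
    show "(\<lambda>k. tpoint {} (w k) $ i) \<longlonglongrightarrow> tpoint I v $ i"
    proof (cases "i \<in> I")
      case True
      have "(\<lambda>k. ereal (w k $ i)) \<longlonglongrightarrow> -\<infinity>"
        unfolding tendsto_MInfty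
      proof
        fix r :: real
        obtain N where "- r < real N" using reals_Archimedean2 by blast
        then have "ereal (w k $ i) < ereal r" if "k \<ge> N" for k
          using wi[of i k] True that by simp
        then show "\<forall>\<^sub>F k in sequentially. ereal (w k $ i) < ereal r"
          using eventually_sequentially by blast
      qed
      with True show ?thesis by simp
    next
      case False
      have "(\<lambda>k. w k $ i - v $ i) \<longlonglongrightarrow> 0"
      proof (rule Lim_null_comparison)
        show "\<forall>\<^sub>F k in sequentially. norm (w k $ i - v $ i) \<le> inverse (real (Suc k))"
          using wi[of i] False by (auto intro!: always_eventually less_imp_le)
        show "(\<lambda>k. inverse (real (Suc k))) \<longlonglongrightarrow> 0"
          by (rule LIMSEQ_inverse_real_of_nat)
      qed
      with False show ?thesis by (simp add: LIM_zero_iff)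
    qed
  qed
  moreover have "\<forall>\<^sub>F k in sequentially. tpoint {} (w k) \<in> closure (tpoint {} ` C)"
    using w closure_subset[of "tpoint {} ` C"] by (intro always_eventually) auto
  ultimately show "tpoint I v \<in> closure (tpoint {} ` C)"
    by (intro Lim_in_closed_set[OF closed_closure]) auto
qed

text \<open>Passing to extended coordinates adds no finite limit points: for empty \<open>I\<close>
  the box criterion is ordinary coordinatewise approximation.\<close>

lemma tpoint_in_closure_finite_iff:
  fixes C :: "(real ^ 'n::finite) set"
  assumes "closed C"
  shows "tpoint {} v \<in> closure (tpoint {} ` C) \<longleftrightarrow> v \<in> C"
proof
  assume L: "tpoint {} v \<in> closure (tpoint {} ` C)"
  have "v \<in> closure C"
    unfolding closure_approachable
  proof (intro allI impI)
    fix e :: real assume "e > 0"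
    \<comment> \<open>The norm is at most the sum of the \<open>CARD('n)\<close> coordinate
      distances, each below \<open>d\<close>.\<close>
    define d where "d = e / real CARD('n)"
    have "d > 0" using \<open>e > 0\<close> by (simp add: d_def)
    then obtain w where w: "w \<in> C" "\<And>i. \<bar>w $ i - v $ i\<bar> < d"
      using L[unfolded tpoint_in_closure_iff] by (metis empty_iff)
    have "norm (w - v) \<le> (\<Sum>i\<in>UNIV. \<bar>(w - v) $ i\<bar>)"
      by (rule norm_le_l1_cart)
    also have "\<dots> < (\<Sum>i\<in>(UNIV::'n set). d)"
      using w(2) by (intro sum_strict_mono) auto
    also have "\<dots> = e" by (simp add: d_def)
    finally show "\<exists>w\<in>C. dist w v < e"
      using w(1) by (auto simp: dist_norm)
  qed
  with assms show "v \<in> C" by simp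
next
  assume "v \<in> C"
  then show "tpoint {} v \<in> closure (tpoint {} ` C)"
    using closure_subset[of "tpoint {} ` C"] by auto
qed

text \<open>Convexity carries the ability to escape to infinity along \<open>I\<close> from one
  point to all points. The coordinates in \<open>I\<close> may escape at different rates, so a
  limiting recession direction could leave some of them fixed; mixing with a single far point of
  \<open>C\<close> moves all of them at once.\<close>

lemma tpoint_in_closure_convex:
  fixes C :: "(real ^ 'n::finite) set"
  assumes "convex C" and p: "p \<in> C" and v: "tpoint I v \<in> closure (tpoint {} ` C)"
  shows "tpoint I p \<in> closure (tpoint {} ` C)"
  unfolding tpoint_in_closure_iff
proof (intro allI impI)
  fix e M :: real assume "e > 0"
  \<comment> \<open>A short step from \<open>p\<close> towards a point of \<open>C\<close> that is far out in the directions of \<open>I\<close>.\<close>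
  define K where "K = 1 + (\<Sum>i\<in>UNIV. \<bar>p $ i\<bar> + \<bar>v $ i\<bar>)"
  have K: "1 + \<bar>p $ i\<bar> + \<bar>v $ i\<bar> \<le> K" for i
    using member_le_sum[of i UNIV "\<lambda>i. \<bar>p $ i\<bar> + \<bar>v $ i\<bar>"] by (simp add: K_def)
  have "K \<ge> 1" unfolding K_def by (simp add: sum_nonneg)
  define c where "c = min 1 (e / (2 * K))"
  have c: "0 < c" "c \<le> 1" "c * K < e"
  proof -
    show "0 < c" "c \<le> 1" using \<open>e > 0\<close> \<open>K \<ge> 1\<close> by (auto simp: c_def)
    have "c * K \<le> e / (2 * K) * K"
      using \<open>K \<ge> 1\<close> by (intro mult_right_mono) (auto simp: c_def)
    also have "\<dots> < e" using \<open>K \<ge> 1\<close> \<open>e > 0\<close> by simp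
    finally show "c * K < e" .
  qed
  \<comment> \<open>Scaled by \<open>c\<close>, this bound becomes \<open>M - K\<close>, which
    leaves room for the contribution of \<open>p\<close>.\<close>
  obtain w where w: "w \<in> C"
      and wi: "\<And>i. if i \<in> I then w $ i < (M - K) / c else \<bar>w $ i - v $ i\<bar> < 1"
    using v[unfolded tpoint_in_closure_iff, rule_format, of 1 "(M - K) / c"] by auto
  define q where "q = (1 - c) *\<^sub>R p + c *\<^sub>R w"
  have "q \<in> C"
    unfolding q_def using assms(1) p w c by (intro convexD) auto
  moreover have "if i \<in> I then q $ i < M else \<bar>q $ i - p $ i\<bar> < e" for i
  proof (cases "i \<in> I")
    case True
    have "(1 - c) * p $ i \<le> 1 * \<bar>p $ i\<bar>"
      using c by (intro order_trans[OF mult_left_mono[OF abs_ge_self] mult_right_mono]) auto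
    also have "\<dots> \<le> K" using K[of i] by simp
    finally have "(1 - c) * p $ i \<le> K" .
    moreover have "c * w $ i < M - K"
      using wi[of i] True c by (simp add: field_simps)
    ultimately show ?thesis using True by (simp add: q_def)
  next
    case False
    have "q $ i - p $ i = c * (w $ i - p $ i)" by (simp add: q_def algebra_simps)
    moreover have "\<bar>w $ i - p $ i\<bar> \<le> K"
      using wi[of i] False K[of i] by auto
    then have "c * \<bar>w $ i - p $ i\<bar> \<le> c * K" using c by (intro mult_left_mono) auto
    with c have "c * \<bar>w $ i - p $ i\<bar> < e" by linarith
    ultimately show ?thesis using False c by (simp add: abs_mult)
  qed
  ultimately show "\<exists>w\<in>C. \<forall>i. if i \<in> I then w $ i < M else \<bar>w $ i - p $ i\<bar> < e"
    by blast
qed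

text \<open>Domains and mobile faces have this form, where \<open>\<C>\<close> consists of half-spaces and hyperplanes.\<close>

definition tclosed :: "'n::finite set \<Rightarrow> (real ^ 'n) set set \<Rightarrow> (ereal ^ 'n) set" where
  "tclosed J \<C> = tspace J \<inter> (\<Inter>C\<in>\<C>. closure (tpoint {} ` C))"

lemma mobile_face_tclosed:
  assumes "E \<in> mobile_faces J H"
  obtains \<C> where "E = tclosed J \<C>" "\<forall>C\<in>\<C>. closed C \<and> convex C"
proof -
  obtain S where S: "E = tdomain J H \<inter> (\<Inter>(j, a)\<in>S. half_space_boundary j a)"
    using assms by (auto simp: mobile_faces_def)
  let ?\<C> = "(\<lambda>(j, a). {v. j \<bullet> v \<le> a}) ` H \<union> (\<lambda>(j, a). {v. j \<bullet> v = a}) ` S"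
  show ?thesis
  proof
    show "E = tclosed J ?\<C>"
      by (auto simp: S tclosed_def tdomain_def half_space_def half_space_boundary_def)
  qed (auto simp: closed_halfspace_le closed_hyperplane convex_halfspace_le convex_hyperplane)
qed

lemma fin_part_tclosed:
  assumes "\<And>C. C \<in> \<C> \<Longrightarrow> closed C"
  shows "fin_part (tclosed J \<C>) = coord_space J \<inter> \<Inter>\<C>"
proof -
  have "tpoint {} v \<in> tspace J \<longleftrightarrow> v \<in> coord_space J" for v
    by (simp add: tspace_def coord_space_def zero_ereal_def)
  then show ?thesis
    using assms by (auto simp: slice_def tclosed_def tpoint_in_closure_finite_iff)
qed

lemma fin_part_tdomain:
  "fin_part (tdomain J H) = coord_space J \<inter> {v. \<forall>(j, a)\<in>H. j \<bullet> v \<le> a}"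
proof -
  have "tdomain J H = tclosed J ((\<lambda>(j, a). {v. j \<bullet> v \<le> a}) ` H)"
    by (auto simp: tclosed_def tdomain_def half_space_def)
  moreover have "fin_part \<dots> = coord_space J \<inter> \<Inter>((\<lambda>(j, a). {v. j \<bullet> v \<le> a}) ` H)"
    by (rule fin_part_tclosed) (auto simp: closed_halfspace_le)
  ultimately show ?thesis by auto
qed

lemma tpoint_in_half_space_boundary_iff:
  "tpoint {} v \<in> half_space_boundary j a \<longleftrightarrow> j \<bullet> v = a"
  unfolding half_space_boundary_def
  by (subst tpoint_in_closure_finite_iff) (auto simp: closed_hyperplane)


section \<open>Mobile faces and wave tangent spaces\<close>

lemma subspace_parallel_space: "subspace (parallel_space E)"
  by (simp add: parallel_space_def)

lemma diff_in_parallel_space: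
  "u \<in> fin_part E \<Longrightarrow> v \<in> fin_part E \<Longrightarrow> u - v \<in> parallel_space E"
  unfolding parallel_space_def by (rule span_base) blast

lemma parallel_space_eq_span:
  assumes "p \<in> fin_part E"
  shows "parallel_space E = span ((\<lambda>x. x - p) ` fin_part E)"
proof
  show "span ((\<lambda>x. x - p) ` fin_part E) \<subseteq> parallel_space E"
    using assms
    by (intro span_minimal subspace_parallel_space) (auto intro: diff_in_parallel_space)
  show "parallel_space E \<subseteq> span ((\<lambda>x. x - p) ` fin_part E)"
    unfolding parallel_space_def
  proof (rule span_minimal, clarify)
    fix u v assume "u \<in> fin_part E" "v \<in> fin_part E"
    then have "(u - p) - (v - p) \<in> span ((\<lambda>x. x - p) ` fin_part E)"
      by (intro span_diff span_base imageI)
    then show "u - v \<in> span ((\<lambda>x. x - p) ` fin_part E)" by simp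
  qed simp
qed

lemma aff_dim_eq_dim_parallel_space:
  assumes "p \<in> fin_part E"
  shows "aff_dim (fin_part E) = int (dim (parallel_space E))"
  using aff_dim_eq_dim_subtract[OF hull_inc[OF assms]] parallel_space_eq_span[OF assms]
  by (simp add: dim_span)

text \<open>The projection of the real part forgetting the coordinates in \<open>sed y\<close> maps into the slice
  through \<open>y\<close>. As regularity makes the slice smaller by exactly \<open>card (sed y)\<close> dimensions,
  the fibres of the projection must be full coordinate spaces and the image as large as the
  slice.\<close>

lemma regular_tclosed:
  fixes J :: "'n::finite set"
  assumes E: "E = tclosed J \<C>" and cl: "\<And>C. C \<in> \<C> \<Longrightarrow> closed C"
    and cv: "\<And>C. C \<in> \<C> \<Longrightarrow> convex C"
    and reg: "regular_at_infinity E" and y: "y \<in> E"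
  shows "fin_part E \<noteq> {}" and "coord_space (sed y) \<subseteq> parallel_space E"
    and "p \<in> fin_part E \<Longrightarrow> realvec y - p \<in> parallel_space E"
proof -
  define I where "I = sed y"
  have EJ: "E \<subseteq> tspace J" by (auto simp: E tclosed_def)
  have yI: "tpoint I (realvec y) = y"
    unfolding I_def using y EJ by (intro tpoint_sed_realvec) (auto simp: tspace_def)
  have yS: "realvec y \<in> slice I E"
    unfolding I_def by (rule realvec_in_slice[OF y EJ])
  then have dim1: "aff_dim (slice I E) = aff_dim (fin_part E) - int (card I)"
    using reg by (auto simp: regular_at_infinity_def tdim_def)
  \<comment> \<open>An empty real part has \<open>aff_dim\<close> equal to \<open>-1\<close>, so by
    \<open>dim1\<close> the slice would have negative dimension although it contains
    \<open>realvec y\<close>.\<close>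
  have "aff_dim (slice I E) \<ge> 0"
    using yS aff_dim_negative_iff[of "slice I E"] by (metis empty_iff not_le)
  then show ne: "fin_part E \<noteq> {}"
    using dim1 by (auto simp: aff_dim_empty)
  have main: "coord_space I \<subseteq> parallel_space E \<and> realvec y - p \<in> parallel_space E"
    if p: "p \<in> fin_part E" for p
  proof -
    define pr where "pr = (\<lambda>v::real^'n. \<chi> i. if i \<in> I then 0 else v $ i)"
    have prI: "v - pr v \<in> coord_space I" for v
      by (simp add: pr_def coord_space_def)
    have pr: "pr v \<in> slice I E" if v: "v \<in> fin_part E" for v
    proof -
      have "fin_part E = coord_space J \<inter> \<Inter>\<C>"
        unfolding E by (rule fin_part_tclosed) (rule cl)
      then have vJ: "v \<in> coord_space J" and vC: "\<And>C. C \<in> \<C> \<Longrightarrow> v \<in> C"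
        using v by auto
      have eq: "tpoint I (pr v) = tpoint I v" by (simp add: vec_eq_iff pr_def)
      have IJ: "I \<subseteq> J"
      proof
        fix i assume "i \<in> I"
        then have "y $ i \<noteq> 0" by (simp add: I_def sed_def)
        then show "i \<in> J" using y EJ by (auto simp: tspace_def)
      qed
      have "tpoint I v \<in> tspace J"
        using vJ IJ by (auto simp: tspace_def coord_space_def zero_ereal_def)
      moreover have "tpoint I v \<in> closure (tpoint {} ` C)" if C: "C \<in> \<C>" for C
      proof (rule tpoint_in_closure_convex[OF cv[OF C] vC[OF C]])
        show "tpoint I (realvec y) \<in> closure (tpoint {} ` C)"
          using y C by (simp add: yI E tclosed_def)
      qed
      ultimately have "tpoint I v \<in> E" by (auto simp: E tclosed_def)
      then show ?thesis by (auto simp: slice_def eq) (simp add: pr_def)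
    qed
    define L where "L = parallel_space E"
    define M where "M = span ((\<lambda>x. x - pr p) ` slice I E)"
    have subM: "subspace M" and subL: "subspace L"
      by (auto simp: M_def L_def subspace_parallel_space)
    have dimM: "int (dim M) = int (dim L) - int (card I)"
      using aff_dim_eq_dim_subtract[OF hull_inc[OF pr[OF p]]] dim1
        aff_dim_eq_dim_parallel_space[OF p]
      by (simp add: M_def L_def dim_span)
    \<comment> \<open>\<open>S\<close> contains \<open>L\<close> and has at most its dimension, so
      the two agree. Since \<open>M\<close> and \<open>coord_space I\<close> are summands of
      \<open>S\<close>, both then lie in \<open>L\<close>.\<close>
    define S where "S = {x + z |x z. x \<in> M \<and> z \<in> coord_space I}"
    have subS: "subspace S"
      unfolding S_def by (rule subspace_sums[OF subM subspace_coord_space])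
    have "dim S \<le> dim M + card I"
      using dim_sums_Int[OF subM subspace_coord_space[of I]]
      by (simp add: S_def dim_coord_space)
    then have dimS: "dim S \<le> dim L" using dimM by linarith
    have "L \<subseteq> S"
      unfolding L_def parallel_space_eq_span[OF p]
    proof (rule span_minimal[OF _ subS], clarify)
      fix u assume u: "u \<in> fin_part E"
      have "pr u - pr p \<in> M"
        unfolding M_def using pr[OF u] by (intro span_base imageI)
      moreover have "(u - pr u) - (p - pr p) \<in> coord_space I"
        by (intro subspace_diff[OF subspace_coord_space] prI)
      moreover have "u - p = (pr u - pr p) + ((u - pr u) - (p - pr p))" by simp
      ultimately show "u - p \<in> S" unfolding S_def by blast
    qed
    then have LS: "L = S" by (rule subspace_dim_equal[OF subL subS]) (rule dimS)
    have "0 \<in> M" "0 \<in> coord_space I"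
      using subM subspace_coord_space by (auto intro: subspace_0)
    then have "coord_space I \<subseteq> L" "M \<subseteq> L"
      unfolding LS S_def by force+
    moreover have "realvec y - pr p \<in> M"
      unfolding M_def using yS by (intro span_base imageI)
    ultimately have "(realvec y - pr p) - (p - pr p) \<in> L"
      by (intro subspace_diff[OF subL, of "realvec y - pr p"]) (use prI in auto)
    with \<open>coord_space I \<subseteq> L\<close> show ?thesis by (simp add: L_def)
  qed
  show "coord_space (sed y) \<subseteq> parallel_space E"
    using main ne by (auto simp: I_def)
  show "p \<in> fin_part E \<Longrightarrow> realvec y - p \<in> parallel_space E"
    using main by blast
qed

lemma polyhedral_complex_face:
  fixes J :: "'n::finite set"
  assumes Y: "polyhedral_complex J n Y" and E: "E \<in> complex_mobile_faces J Y" and y: "y \<in> E"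
  shows "fin_part E \<noteq> {}" and "coord_space (sed y) \<subseteq> parallel_space E"
    and "p \<in> fin_part E \<Longrightarrow> realvec y - p \<in> parallel_space E"
proof -
  obtain H where "E \<in> mobile_faces J H" using E by (auto simp: complex_mobile_faces_def)
  then obtain \<C> where \<C>: "E = tclosed J \<C>" "\<forall>C\<in>\<C>. closed C \<and> convex C"
    by (rule mobile_face_tclosed)
  have reg: "regular_at_infinity E" using Y E by (auto simp: polyhedral_complex_def)
  note face = regular_tclosed[where y = y, OF \<C>(1) _ _ reg y]
  show "fin_part E \<noteq> {}"
    by (rule face(1)) (use \<C> in auto)
  show "coord_space (sed y) \<subseteq> parallel_space E"
    by (rule face(2)) (use \<C> in auto)
  show "realvec y - p \<in> parallel_space E" if "p \<in> fin_part E"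
    by (rule face(3)) (use \<C> that in auto)
qed

text \<open>The two points may have different sedentarities; a finite point \<open>p\<close> of the
  face serves as a common origin. Replacing infinite coordinates by \<open>0\<close> is harmless, as
  divisorial directions are parallel to the face.\<close>

lemma polyhedral_complex_realvec_diff:
  assumes Y: "polyhedral_complex J n Y" and E: "E \<in> complex_mobile_faces J Y"
    and "y \<in> E" "y' \<in> E"
  shows "realvec y - realvec y' \<in> parallel_space E"
proof -
  obtain p where p: "p \<in> fin_part E" using polyhedral_complex_face(1)[OF Y E] assms(3) by blast
  have "(realvec y - p) - (realvec y' - p) \<in> parallel_space E"
    by (rule subspace_diff[OF subspace_parallel_space])
       (use polyhedral_complex_face(3)[OF Y E _ p] assms in blast)+
  then show ?thesis by simp
qed

text \<open>The segment from \<open>u\<close> to \<open>v\<close> can be prolonged beyond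
  \<open>v\<close> inside \<open>S\<close>; if \<open>j\<close> grew from \<open>u\<close> to
  \<open>v\<close>, it would exceed its maximum there.\<close>

lemma inner_constant_of_rel_interior_max:
  fixes S :: "'b::euclidean_space set"
  assumes "convex S" "v \<in> rel_interior S" and le: "\<And>u. u \<in> S \<Longrightarrow> j \<bullet> u \<le> j \<bullet> v"
    and u: "u \<in> S"
  shows "j \<bullet> u = j \<bullet> v"
proof -
  obtain e where e: "e > 1" "(1 - e) *\<^sub>R u + e *\<^sub>R v \<in> S"
    using convex_rel_interior_if2[OF assms(1,2)] hull_inc[OF u] by blast
  have "j \<bullet> ((1 - e) *\<^sub>R u + e *\<^sub>R v) \<le> j \<bullet> v" by (rule le[OF e(2)])
  then have "(e - 1) * (j \<bullet> v) \<le> (e - 1) * (j \<bullet> u)"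
    by (simp add: inner_add_right algebra_simps)
  then have "j \<bullet> v \<le> j \<bullet> u" using e(1) by simp
  with le[OF u] show ?thesis by simp
qed

lemma convex_fin_part_tdomain: "convex (fin_part (tdomain J H))"
proof -
  have "fin_part (tdomain J H) = coord_space J \<inter> (\<Inter>(j, a)\<in>H. {v. j \<bullet> v \<le> a})"
    by (auto simp: fin_part_tdomain)
  moreover have "convex \<dots>"
    by (intro convex_Int convex_INT subspace_imp_convex[OF subspace_coord_space])
       (auto simp: convex_halfspace_le)
  ultimately show ?thesis by simp
qed

lemma closed_fin_part_tdomain: "closed (fin_part (tdomain J H))"
proof -
  have "fin_part (tdomain J H) = coord_space J \<inter> (\<Inter>(j, a)\<in>H. {v. j \<bullet> v \<le> a})"
    by (auto simp: fin_part_tdomain)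
  moreover have "closed \<dots>"
    by (intro closed_Int closed_INT closed_subspace[OF subspace_coord_space] ballI)
       (auto simp: closed_halfspace_le)
  ultimately show ?thesis by simp
qed

lemma convex_fin_part_mobile_face:
  assumes "E \<in> mobile_faces J H"
  shows "convex (fin_part E)"
proof -
  obtain \<C> where \<C>: "E = tclosed J \<C>" "\<forall>C\<in>\<C>. closed C \<and> convex C"
    using assms by (rule mobile_face_tclosed)
  have "fin_part E = coord_space J \<inter> \<Inter>\<C>"
    unfolding \<C>(1) by (rule fin_part_tclosed) (use \<C>(2) in blast)
  moreover have "convex \<dots>"
    by (intro convex_Int convex_Inter subspace_imp_convex[OF subspace_coord_space])
       (use \<C>(2) in blast)
  ultimately show ?thesis by simp
qed

text \<open>The two facets meet in a face of the first, cut out by making some of its defining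
  inequalities equalities. At \<open>v\<close> these inequalities are tight, and a linear form that
  is maximal over \<open>fin_part E\<close> at a relative interior point is constant on it, so they
  are tight on all of \<open>fin_part E\<close>.\<close>

lemma fin_part_face_subset_facet:
  assumes Y: "polyhedral_complex J n Y" and H: "H \<in> Y" "H' \<in> Y"
    and E: "E \<in> mobile_faces J H" and v: "v \<in> rel_interior (fin_part E)"
    and v': "v \<in> fin_part (tdomain J H')"
  shows "fin_part E \<subseteq> fin_part (tdomain J H')"
proof -
  have vE: "v \<in> fin_part E" using v rel_interior_subset by blast
  have EH: "fin_part E \<subseteq> fin_part (tdomain J H)"
    using E by (auto simp: mobile_faces_def slice_def)
  have vin: "tpoint {} v \<in> tdomain J H \<inter> tdomain J H'"
    using vE EH v' by (auto simp: slice_def)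
  \<comment> \<open>The case \<open>H = H'\<close> is included, as a family with one member.\<close>
  have "{H, H'} \<subseteq> Y" "{H, H'} \<noteq> {}" using H by auto
  then have "(\<Inter>K\<in>{H, H'}. tdomain J K) = {} \<or>
      (\<forall>K\<in>{H, H'}. (\<Inter>K'\<in>{H, H'}. tdomain J K') \<in> domain_faces J K)"
    using Y unfolding polyhedral_complex_def by blast
  then have "tdomain J H \<inter> tdomain J H' \<in> domain_faces J H"
    using vin by auto
  then obtain G I where G: "G \<in> mobile_faces J H"
      and GI: "tdomain J H \<inter> tdomain J H' = G \<inter> {y. \<forall>i\<in>I. y $ i = -\<infinity>}"
    by (auto simp: domain_faces_def)
  \<comment> \<open>The intersection contains the finite point \<open>v\<close>, so it is a mobile
    face and not a piece at infinity.\<close>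
  have "I = {}" using vin unfolding GI by auto
  with GI have GH': "tdomain J H \<inter> tdomain J H' = G" by simp
  obtain S where S: "S \<subseteq> H" "G = tdomain J H \<inter> (\<Inter>(j, a)\<in>S. half_space_boundary j a)"
    using G by (auto simp: mobile_faces_def)
  show ?thesis
  proof
    fix u assume u: "u \<in> fin_part E"
    have "tpoint {} u \<in> half_space_boundary j a" if ja: "(j, a) \<in> S" for j a
    proof -
      have "tpoint {} v \<in> half_space_boundary j a"
        using vin ja unfolding GH' S(2) by auto
      then have va: "j \<bullet> v = a" by (simp add: tpoint_in_half_space_boundary_iff)
      have "j \<bullet> w \<le> j \<bullet> v" if "w \<in> fin_part E" for w
        using EH that S(1) ja unfolding va fin_part_tdomain by fastforce
      then have "j \<bullet> u = j \<bullet> v"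
        using inner_constant_of_rel_interior_max[OF convex_fin_part_mobile_face[OF E] v] u by blast
      then show ?thesis by (simp add: tpoint_in_half_space_boundary_iff va)
    qed
    then have "tpoint {} u \<in> G" using u EH S(2) by (auto simp: slice_def)
    then show "u \<in> fin_part (tdomain J H')" using GH' by (auto simp: slice_def)
  qed
qed

lemma small_steps_in_rel_interior:
  fixes S :: "'b::euclidean_space set"
  assumes "v \<in> rel_interior S" and w: "w \<in> span ((\<lambda>x. x - v) ` S)"
  obtains d where "d > 0" "\<And>e. 0 < e \<Longrightarrow> e < d \<Longrightarrow> v + e *\<^sub>R w \<in> S"
proof -
  obtain r where r: "r > 0" "ball v r \<inter> affine hull S \<subseteq> S"
    using assms(1) by (auto simp: mem_rel_interior_ball)
  have vS: "v \<in> S" using assms(1) rel_interior_subset by blast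
  show ?thesis
  proof
    \<comment> \<open>The summand \<open>1\<close> keeps the bound positive when
      \<open>w = 0\<close>.\<close>
    show "r / (norm w + 1) > 0" using r by (simp add: add_nonneg_pos)
    fix e :: real assume e: "0 < e" "e < r / (norm w + 1)"
    have "e * norm w \<le> e * (norm w + 1)" using e by simp
    also have "\<dots> < r" using e(2) by (simp add: pos_less_divide_eq add_nonneg_pos)
    finally have "v + e *\<^sub>R w \<in> ball v r" using e by (simp add: dist_norm)
    moreover have "v + e *\<^sub>R w \<in> affine hull S"
    proof -
      have "affine hull S = (\<lambda>x. v + x) ` span ((\<lambda>x. - v + x) ` S)"
        by (rule affine_hull_span_gen) (rule hull_inc[OF vS])
      moreover have "(\<lambda>x. - v + x) ` S = (\<lambda>x. x - v) ` S" by auto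
      ultimately show ?thesis using w by (auto intro: span_scale)
    qed
    ultimately show "v + e *\<^sub>R w \<in> S" using r by blast
  qed
qed

text \<open>Every facet through \<open>v\<close> contains \<open>E\<close>, so the tangent cone at \<open>v\<close> is invariant under the
  translations parallel to \<open>E\<close>; hence so is each maximal subspace of it.\<close>

lemma parallel_space_subset_wave_pre:
  fixes J :: "'n::finite set"
  assumes Y: "polyhedral_complex J n Y" and E: "E \<in> complex_mobile_faces J Y"
    and v: "v \<in> rel_interior (fin_part E)"
  shows "parallel_space E \<subseteq> wave_pre (complex_support J Y) (tpoint {} v)"
proof -
  let ?Z = "complex_support J Y"
  obtain H where H: "H \<in> Y" "E \<in> mobile_faces J H"
    using E by (auto simp: complex_mobile_faces_def)
  have vE: "v \<in> fin_part E" using v rel_interior_subset by blast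
  have cone: "u \<in> tangent_cone ?Z (tpoint {} v) \<longleftrightarrow>
      (\<exists>e0>0. \<forall>e. 0 < e \<and> e < e0 \<longrightarrow> tpoint {} (v + e *\<^sub>R u) \<in> ?Z)" for u
    by (simp add: tangent_cone_def)
  have inv: "u + w \<in> tangent_cone ?Z (tpoint {} v)"
    if u: "u \<in> tangent_cone ?Z (tpoint {} v)" and w: "w \<in> parallel_space E" for u w
  proof -
    have fin: "finite {H \<in> Y. v \<notin> fin_part (tdomain J H)}"
      using Y by (auto simp: polyhedral_complex_def)
    \<comment> \<open>\<open>N\<close> avoids the finitely many closed facets that miss
      \<open>v\<close>. A facet reached by a short step along \<open>u\<close> must therefore pass
      through \<open>v\<close>, and hence contain the real part of \<open>E\<close>.\<close>
    define N where "N = (\<Inter>H\<in>{H \<in> Y. v \<notin> fin_part (tdomain J H)}. - fin_part (tdomain J H))"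
    have "open N"
      unfolding N_def using fin closed_fin_part_tdomain by (intro open_INT) auto
    moreover have "v \<in> N" by (simp add: N_def)
    ultimately obtain r where r: "r > 0" "ball v r \<subseteq> N"
      using open_contains_ball by blast
    obtain d1 where d1: "d1 > 0" "\<And>e. 0 < e \<Longrightarrow> e < d1 \<Longrightarrow> tpoint {} (v + e *\<^sub>R u) \<in> ?Z"
      using u cone by blast
    obtain d2 where d2: "d2 > 0" "\<And>e. 0 < e \<Longrightarrow> e < d2 \<Longrightarrow> v + e *\<^sub>R w \<in> fin_part E"
      using small_steps_in_rel_interior[OF v] w parallel_space_eq_span[OF vE] by metis
    define d where "d = min (min d1 d2) (r / (norm u + 1)) / 2"
    have d: "d > 0" "2 * d \<le> d1" "2 * d \<le> d2" "2 * d \<le> r / (norm u + 1)"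
      using d1 d2 r by (auto simp: d_def add_nonneg_pos)
    have "tpoint {} (v + e *\<^sub>R (u + w)) \<in> ?Z" if e: "0 < e" "e < d" for e
    proof -
      \<comment> \<open>The point to be reached is the midpoint of the steps along \<open>u\<close>
        and along \<open>w\<close> of double length, both in one convex facet; \<open>d\<close> was
        halved to allow for the doubling.\<close>
      define f where "f = 2 * e"
      have f: "0 < f" "f < d1" "f < d2" "f < r / (norm u + 1)"
        using e d by (auto simp: f_def)
      have "f * norm u \<le> f * (norm u + 1)" using f by simp
      also have "\<dots> < r" using f(4) by (simp add: pos_less_divide_eq add_nonneg_pos)
      finally have "v + f *\<^sub>R u \<in> N" using r(2) f by (auto simp: dist_norm subset_iff)
      moreover obtain H' where H': "H' \<in> Y" "tpoint {} (v + f *\<^sub>R u) \<in> tdomain J H'"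
        using d1(2)[OF f(1,2)] by (auto simp: complex_support_def)
      ultimately have vH': "v \<in> fin_part (tdomain J H')"
        by (auto simp: N_def slice_def)
      have 1: "v + f *\<^sub>R u \<in> fin_part (tdomain J H')" using H' by (simp add: slice_def)
      have 2: "v + f *\<^sub>R w \<in> fin_part (tdomain J H')"
        using fin_part_face_subset_facet[OF Y H(1) H'(1) H(2) v vH'] d2(2)[OF f(1,3)] by blast
      have "(1/2) *\<^sub>R (v + f *\<^sub>R u) + (1/2) *\<^sub>R (v + f *\<^sub>R w) \<in> fin_part (tdomain J H')"
        using convexD[OF convex_fin_part_tdomain 1 2, of "1/2" "1/2"] by simp
      also have "(1/2) *\<^sub>R (v + f *\<^sub>R u) + (1/2) *\<^sub>R (v + f *\<^sub>R w) = v + e *\<^sub>R (u + w)"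
        by (simp add: f_def vec_eq_iff algebra_simps)
      finally show ?thesis using H'(1) by (auto simp: complex_support_def slice_def)
    qed
    with d(1) cone show ?thesis by blast
  qed
  show ?thesis
    unfolding wave_pre_def
  proof (rule Inter_greatest, clarify)
    fix L w assume L: "maximal_subspace (tangent_cone ?Z (tpoint {} v)) L"
      and w: "w \<in> parallel_space E"
    define L' where "L' = {x + z |x z. x \<in> L \<and> z \<in> parallel_space E}"
    have sub: "subspace L" using L by (simp add: maximal_subspace_def)
    then have "subspace L'"
      unfolding L'_def by (rule subspace_sums[OF _ subspace_parallel_space])
    moreover have "L' \<subseteq> tangent_cone ?Z (tpoint {} v)"
      using inv L by (auto simp: L'_def maximal_subspace_def)
    moreover have "L \<subseteq> L'"
      unfolding L'_def using subspace_0[OF subspace_parallel_space] by force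
    ultimately have "L' = L" using L by (simp add: maximal_subspace_def)
    moreover have "w \<in> L'"
      unfolding L'_def using subspace_0[OF sub] w by force
    ultimately show "w \<in> L" by simp
  qed
qed

lemma subspace_wave_pre: "subspace (wave_pre Z y)"
  unfolding wave_pre_def by (rule subspace_Inter) (auto simp: maximal_subspace_def)

text \<open>\<open>E\<^sub>0\<close> and \<open>v\<^sub>0\<close> only witness that the choice by
  \<open>SOME\<close> succeeds. The face returned is a parent belonging to the chosen point, which
  may differ from \<open>E\<^sub>0\<close>.\<close>

lemma wave_tangent_contains_parallel_space:
  assumes Y: "polyhedral_complex J n Y"
    and "is_parent J Y y E\<^sub>0" "v\<^sub>0 \<in> rel_interior (fin_part E\<^sub>0)"
  obtains E where "is_parent J Y y E" "parallel_space E \<subseteq> wave_tangent J Y y"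
proof -
  define v where "v = (SOME v. \<exists>E. is_parent J Y y E \<and> v \<in> rel_interior (fin_part E))"
  have "\<exists>E. is_parent J Y y E \<and> v \<in> rel_interior (fin_part E)"
    unfolding v_def by (rule someI) (use assms in blast)
  then obtain E where E: "is_parent J Y y E" "v \<in> rel_interior (fin_part E)" by blast
  have "parallel_space E \<subseteq> wave_tangent J Y y"
    using parallel_space_subset_wave_pre[OF Y _ E(2)] E(1)
    by (simp add: wave_tangent_def v_def is_parent_def)
  with E(1) show ?thesis by (rule that)
qed


section \<open>Mobile points along a path in a chart\<close>

lemma subspace_chart_wave: "subspace (chart_wave c x)"
  by (simp add: chart_wave_def wave_tangent_def subspace_wave_pre)

lemma tropical_chart_polyhedral_complex:
  assumes "tropical_chart X c"
  obtains n where "polyhedral_complex (chart_coords c) n (chart_complex c)"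
  using assms by (auto simp: tropical_chart_def)

lemma tropical_chart_in_tspace:
  assumes "tropical_chart X c" "x \<in> chart_dom c"
  shows "chart_map c x \<in> tspace (chart_coords c)"
proof -
  have "chart_map c ` chart_dom c \<subseteq> chart_support c"
    using assms(1) openin_subset by (fastforce simp: tropical_chart_def)
  with assms(2) show ?thesis
    by (auto simp: chart_support_def complex_support_def tdomain_def)
qed

lemma tropical_chart_continuous_on:
  assumes c: "tropical_chart X c" and \<gamma>: "pathin (subtopology X (chart_dom c)) \<gamma>"
  shows "continuous_on {0..1} (\<lambda>t. chart_map c (\<gamma> t))"
proof -
  have "embedding_map (subtopology X (chart_dom c)) euclidean (chart_map c)"
    using c by (simp add: tropical_chart_def)
  then have "continuous_map (subtopology X (chart_dom c)) euclidean (chart_map c)"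
    unfolding embedding_map_def
    using homeomorphic_imp_continuous_map continuous_map_into_fulltopology by blast
  then have "continuous_map (top_of_set {0..1::real}) euclidean (chart_map c \<circ> \<gamma>)"
    using \<gamma> unfolding pathin_def by (rule continuous_map_compose[rotated])
  then show ?thesis by (simp add: o_def)
qed

section \<open>Finiteness and closedness of the mobile faces\<close>

lemma finite_complex_mobile_faces:
  assumes "polyhedral_complex J n Y"
  shows "finite (complex_mobile_faces J Y)"
proof -
  have "finite (mobile_faces J H)" if "H \<in> Y" for H
  proof (rule finite_subset)
    show "mobile_faces J H \<subseteq>
        (\<lambda>S. tdomain J H \<inter> (\<Inter>(j, a)\<in>S. half_space_boundary j a)) ` Pow H"
      by (auto simp: mobile_faces_def)
    show "finite ((\<lambda>S. tdomain J H \<inter> (\<Inter>(j, a)\<in>S. half_space_boundary j a)) ` Pow H)"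
      using that assms by (auto simp: polyhedral_complex_def)
  qed
  with assms show ?thesis by (auto simp: complex_mobile_faces_def polyhedral_complex_def)
qed

text \<open>\<open>tspace J\<close> excludes \<infinity> and need not be closed. Removing a face
  from a neighbourhood is done by removing \<open>K\<close>, whose complement is open in the whole
  extended space.\<close>

lemma mobile_face_closed_in_tspace:
  assumes "E \<in> complex_mobile_faces J Y"
  obtains K where "closed K" "E = tspace J \<inter> K"
proof -
  obtain H where "E \<in> mobile_faces J H" using assms by (auto simp: complex_mobile_faces_def)
  then obtain \<C> where "E = tclosed J \<C>" by (rule mobile_face_tclosed)
  then have "E = tspace J \<inter> (\<Inter>C\<in>\<C>. closure (tpoint {} ` C))" by (simp add: tclosed_def)
  moreover have "closed (\<Inter>C\<in>\<C>. closure (tpoint {} ` C))" by auto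
  ultimately show ?thesis by (rule that[rotated])
qed

lemma open_meeting_only_faces_at:
  fixes J :: "'n::finite set"
  assumes Y: "polyhedral_complex J n Y" and z: "z \<in> tspace J"
  obtains U where "open U" "z \<in> U"
    "\<And>E z'. E \<in> complex_mobile_faces J Y \<Longrightarrow> z' \<in> E \<Longrightarrow> z' \<in> U \<Longrightarrow> z \<in> E"
proof -
  define F where "F = {E \<in> complex_mobile_faces J Y. z \<notin> E}"
  have "\<forall>E\<in>F. \<exists>K. closed K \<and> E = tspace J \<inter> K"
    unfolding F_def using mobile_face_closed_in_tspace by (metis (lifting) mem_Collect_eq)
  then obtain K where K: "\<And>E. E \<in> F \<Longrightarrow> closed (K E)" "\<And>E. E \<in> F \<Longrightarrow> E = tspace J \<inter> K E"
    by metis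
  have "finite F" using finite_complex_mobile_faces[OF Y] by (simp add: F_def)
  show ?thesis
  proof
    show "open (\<Inter>E\<in>F. - K E)"
      using \<open>finite F\<close> K(1) by (intro open_INT) auto
    show "z \<in> (\<Inter>E\<in>F. - K E)"
    proof
      fix E assume E: "E \<in> F"
      then have "z \<notin> tspace J \<inter> K E" using K(2) by (auto simp: F_def)
      with z show "z \<in> - K E" by simp
    qed
    show "z \<in> E" if "E \<in> complex_mobile_faces J Y" "z' \<in> E" "z' \<in> (\<Inter>E\<in>F. - K E)" for E z'
    proof (rule ccontr)
      assume "z \<notin> E"
      then have E: "E \<in> F" using that(1) by (simp add: F_def)
      then have "z' \<in> K E" using K(2) that(2) by blast
      with that(3) E show False by blast
    qed
  qed
qed

section \<open>Mobile representatives in a chart\<close>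

definition mobile_vec :: "('a, 'n::finite) tchart \<Rightarrow> ('a \<Rightarrow> 'a) \<Rightarrow> 'a \<Rightarrow> real ^ 'n" where
  "mobile_vec c y x = realvec (chart_map c (y x))"

text \<open>The choice \<open>y\<close> is a parameter, so that two choices on one space can be
  compared through two instances.\<close>

locale mobile_choice_space =
  fixes X :: "'a topology" and \<A> :: "('a, 'n::finite) tchart set" and y :: "'a \<Rightarrow> 'a"
  assumes space: "tropical_space X \<A>"
    and choice: "mobile_choice X \<A> y"
begin

lemma chart: "c \<in> \<A> \<Longrightarrow> tropical_chart X c"
  using space by (simp add: tropical_space_def)

lemma chart_dom_topspace: "c \<in> \<A> \<Longrightarrow> x \<in> chart_dom c \<Longrightarrow> x \<in> topspace X"
  using space by (auto simp: tropical_space_def)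

lemma mobile_point:
  assumes "c \<in> \<A>" "x \<in> chart_dom c"
  shows "y x \<in> chart_dom c" "chart_map c (y x) = tpoint {} (mobile_vec c y x)"
    "\<exists>E. is_parent (chart_coords c) (chart_complex c) (chart_map c x) E \<and>
         mobile_vec c y x \<in> rel_interior (fin_part E)"
    "mobile_vec c y x - realvec (chart_map c x) \<in> coord_space (sed (chart_map c x))"
proof -
  have *: "y x \<in> chart_dom c" "sed (chart_map c (y x)) = {}"
      "\<And>i. i \<notin> sed (chart_map c x) \<Longrightarrow> chart_map c (y x) $ i = chart_map c x $ i"
    and E: "\<exists>E. is_parent (chart_coords c) (chart_complex c) (chart_map c x) E \<and>
         mobile_vec c y x \<in> rel_interior (fin_part E)"
    using choice chart_dom_topspace[OF assms] assms
    unfolding mobile_choice_def mobile_vec_def by blast+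
  show "y x \<in> chart_dom c" by (rule *)
  have "chart_map c (y x) \<in> tspace (chart_coords c)"
    using tropical_chart_in_tspace[OF chart] assms * by blast
  then have "tpoint (sed (chart_map c (y x))) (realvec (chart_map c (y x))) = chart_map c (y x)"
    by (intro tpoint_sed_realvec) (auto simp: tspace_def)
  then show "chart_map c (y x) = tpoint {} (mobile_vec c y x)"
    by (simp add: mobile_vec_def *(2))
  show "\<exists>E. is_parent (chart_coords c) (chart_complex c) (chart_map c x) E \<and>
         mobile_vec c y x \<in> rel_interior (fin_part E)" by (rule E)
  show "mobile_vec c y x - realvec (chart_map c x) \<in> coord_space (sed (chart_map c x))"
    using *(3) by (simp add: coord_space_def mobile_vec_def realvec_def)
qed

lemma chart_wave_parent:
  assumes "c \<in> \<A>" "x \<in> chart_dom c"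
  obtains E where "E \<in> complex_mobile_faces (chart_coords c) (chart_complex c)"
    "chart_map c x \<in> E" "parallel_space E \<subseteq> chart_wave c x"
proof -
  obtain n where Y: "polyhedral_complex (chart_coords c) n (chart_complex c)"
    using chart[OF assms(1)] by (rule tropical_chart_polyhedral_complex)
  obtain E\<^sub>0 where "is_parent (chart_coords c) (chart_complex c) (chart_map c x) E\<^sub>0"
      "mobile_vec c y x \<in> rel_interior (fin_part E\<^sub>0)"
    using mobile_point(3)[OF assms] by blast
  then obtain E where "is_parent (chart_coords c) (chart_complex c) (chart_map c x) E"
      "parallel_space E \<subseteq> chart_wave c x"
    unfolding chart_wave_def by (rule wave_tangent_contains_parallel_space[OF Y])
  then show ?thesis by (intro that) (auto simp: is_parent_def)
qed

text \<open>This makes the displacement between two choices of mobile points a wave cochain of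
  degree \<open>0\<close>.\<close>

lemma wave_div_subset_chart_wave:
  assumes "c \<in> \<A>" "x \<in> chart_dom c"
  shows "wave_div (chart_map c x) \<subseteq> chart_wave c x"
proof -
  obtain n where Y: "polyhedral_complex (chart_coords c) n (chart_complex c)"
    using chart[OF assms(1)] by (rule tropical_chart_polyhedral_complex)
  obtain E where E: "E \<in> complex_mobile_faces (chart_coords c) (chart_complex c)"
    "chart_map c x \<in> E" "parallel_space E \<subseteq> chart_wave c x"
    using chart_wave_parent[OF assms] .
  then show ?thesis
    using polyhedral_complex_face(2)[OF Y E(1,2)] by (simp add: coord_space_eq_wave_div)
qed

text \<open>Near \<open>\<gamma> t\<^sub>0\<close> the path only meets faces containing \<open>\<gamma> t\<^sub>0\<close>. The displacement to \<open>\<gamma> t\<close> is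
  therefore parallel to the parent of the face through \<open>\<gamma> t\<close>, and so are the divisorial
  directions at both points.\<close>

lemma mobile_vec_locally_constant:
  assumes c: "c \<in> \<A>" and \<gamma>: "pathin (subtopology X (chart_dom c)) \<gamma>" and t\<^sub>0: "t\<^sub>0 \<in> {0..1}"
  obtains T where "openin (top_of_set {0..1}) T" "t\<^sub>0 \<in> T"
    "\<forall>t\<in>T. mobile_vec c y (\<gamma> t\<^sub>0) - mobile_vec c y (\<gamma> t) \<in> chart_wave c (\<gamma> t)"
proof -
  let ?f = "\<lambda>t. chart_map c (\<gamma> t)" and ?J = "chart_coords c" and ?Y = "chart_complex c"
  obtain n where Y: "polyhedral_complex ?J n ?Y"
    using chart[OF c] by (rule tropical_chart_polyhedral_complex)
  have dom: "\<gamma> t \<in> chart_dom c" if "t \<in> {0..1}" for t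
    using \<gamma> that by (auto simp: pathin_def continuous_map_in_subtopology)
  have "?f t\<^sub>0 \<in> tspace ?J"
    using tropical_chart_in_tspace[OF chart[OF c]] dom t\<^sub>0 by blast
  then obtain U where U: "open U" "?f t\<^sub>0 \<in> U"
    "\<And>E z'. E \<in> complex_mobile_faces ?J ?Y \<Longrightarrow> z' \<in> E \<Longrightarrow> z' \<in> U \<Longrightarrow> ?f t\<^sub>0 \<in> E"
    using open_meeting_only_faces_at[OF Y] by blast
  show ?thesis
  proof
    show "openin (top_of_set {0..1}) ({0..1} \<inter> ?f -` U)"
      using tropical_chart_continuous_on[OF chart[OF c] \<gamma>] U(1)
      by (rule continuous_openin_preimage_gen)
    show "t\<^sub>0 \<in> {0..1} \<inter> ?f -` U" using t\<^sub>0 U(2) by simp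
    show "\<forall>t\<in>{0..1} \<inter> ?f -` U.
        mobile_vec c y (\<gamma> t\<^sub>0) - mobile_vec c y (\<gamma> t) \<in> chart_wave c (\<gamma> t)"
    proof
      fix t assume t: "t \<in> {0..1} \<inter> ?f -` U"
      then have x: "\<gamma> t \<in> chart_dom c" using dom by blast
      obtain E where E: "E \<in> complex_mobile_faces ?J ?Y" "?f t \<in> E"
          "parallel_space E \<subseteq> chart_wave c (\<gamma> t)"
        using chart_wave_parent[OF c x] .
      have t\<^sub>0E: "?f t\<^sub>0 \<in> E" using U(3)[OF E(1,2)] t by simp
      note sub = subspace_parallel_space[of E]
      have "realvec (?f t\<^sub>0) - realvec (?f t) \<in> parallel_space E"
        by (rule polyhedral_complex_realvec_diff[OF Y E(1) t\<^sub>0E E(2)])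
      moreover have "mobile_vec c y (\<gamma> t\<^sub>0) - realvec (?f t\<^sub>0) \<in> parallel_space E"
        using mobile_point(4)[OF c dom[OF t\<^sub>0]] polyhedral_complex_face(2)[OF Y E(1) t\<^sub>0E] by blast
      ultimately have "(realvec (?f t\<^sub>0) - realvec (?f t))
          + (mobile_vec c y (\<gamma> t\<^sub>0) - realvec (?f t\<^sub>0)) \<in> parallel_space E"
        by (rule subspace_add[OF sub])
      moreover have "mobile_vec c y (\<gamma> t) - realvec (?f t) \<in> parallel_space E"
        using mobile_point(4)[OF c x] polyhedral_complex_face(2)[OF Y E(1,2)] by blast
      ultimately have "(realvec (?f t\<^sub>0) - realvec (?f t))
          + (mobile_vec c y (\<gamma> t\<^sub>0) - realvec (?f t\<^sub>0))
          - (mobile_vec c y (\<gamma> t) - realvec (?f t)) \<in> parallel_space E"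
        by (rule subspace_diff[OF sub])
      then have "mobile_vec c y (\<gamma> t\<^sub>0) - mobile_vec c y (\<gamma> t) \<in> parallel_space E"
        by (simp add: algebra_simps)
      with E(3) show "mobile_vec c y (\<gamma> t\<^sub>0) - mobile_vec c y (\<gamma> t) \<in> chart_wave c (\<gamma> t)" by blast
    qed
  qed
qed

text \<open>Agreement modulo \<open>W\<close> is an equivalence relation on the parameters, and
  connectedness of the interval makes it total once it holds locally. \<open>W\<close> is compared
  only with the wave spaces over the open interval, so an end of the path may centre a neighbourhood
  but must not be the other point compared.\<close>

lemma mobile_vec_diff_in_wave:
  assumes c: "c \<in> \<A>" and \<gamma>: "pathin (subtopology X (chart_dom c)) \<gamma>"
    and W: "subspace W" "\<And>t. t \<in> {0<..<1} \<Longrightarrow> chart_wave c (\<gamma> t) \<subseteq> W"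
  shows "mobile_vec c y (\<gamma> 1) - mobile_vec c y (\<gamma> 0) \<in> W"
proof -
  have "mobile_vec c y (\<gamma> 0) - mobile_vec c y (\<gamma> 1) \<in> W"
  proof (rule connected_equivalence_relation[where S = "{0..1::real}" and a = 0 and b = 1
        and R = "\<lambda>s t. mobile_vec c y (\<gamma> s) - mobile_vec c y (\<gamma> t) \<in> W"])
    show "mobile_vec c y (\<gamma> t) - mobile_vec c y (\<gamma> s) \<in> W"
      if "mobile_vec c y (\<gamma> s) - mobile_vec c y (\<gamma> t) \<in> W" for s t
      using subspace_neg[OF W(1) that] by simp
    show "mobile_vec c y (\<gamma> r) - mobile_vec c y (\<gamma> t) \<in> W"
      if "mobile_vec c y (\<gamma> r) - mobile_vec c y (\<gamma> s) \<in> W"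
        "mobile_vec c y (\<gamma> s) - mobile_vec c y (\<gamma> t) \<in> W" for r s t
      using subspace_add[OF W(1) that] by simp
    fix t\<^sub>0 :: real assume t\<^sub>0: "t\<^sub>0 \<in> {0..1}"
    obtain T where T: "openin (top_of_set {0..1}) T" "t\<^sub>0 \<in> T"
      "\<forall>t\<in>T. mobile_vec c y (\<gamma> t\<^sub>0) - mobile_vec c y (\<gamma> t) \<in> chart_wave c (\<gamma> t)"
      by (rule mobile_vec_locally_constant[OF c \<gamma> t\<^sub>0])
    \<comment> \<open>Intersecting with \<open>V\<close> removes each end of the interval unless it
      is \<open>t\<^sub>0\<close> itself.\<close>
    define V where "V = (if t\<^sub>0 = 0 then UNIV else {0<..}) \<inter> (if t\<^sub>0 = 1 then UNIV else {..<1::real})"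
    have "open V" by (simp add: V_def open_Int)
    show "\<exists>T. openin (top_of_set {0..1}) T \<and> t\<^sub>0 \<in> T \<and>
        (\<forall>t\<in>T. mobile_vec c y (\<gamma> t\<^sub>0) - mobile_vec c y (\<gamma> t) \<in> W)"
    proof (intro exI conjI ballI)
      show "openin (top_of_set {0..1}) (T \<inter> V)"
        using T(1) \<open>open V\<close> by (rule openin_Int_open)
      show "t\<^sub>0 \<in> T \<inter> V" using T(2) t\<^sub>0 by (auto simp: V_def)
      fix t assume t: "t \<in> T \<inter> V"
      show "mobile_vec c y (\<gamma> t\<^sub>0) - mobile_vec c y (\<gamma> t) \<in> W"
      proof (cases "t = t\<^sub>0")
        case True
        then show ?thesis using subspace_0[OF W(1)] by simp
      next
        case False
        have "t \<in> {0..1}" using t openin_subset[OF T(1)] by auto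
        with False t have "t \<in> {0<..<1}"
          by (cases "t = 0"; cases "t = 1") (auto simp: V_def split: if_splits)
        with T(3) W(2) t show ?thesis by blast
      qed
    qed
  qed auto
  then show ?thesis using subspace_neg[OF W(1)] by fastforce
qed

text \<open>\<open>y x\<close> lies in both charts at finite positions, and at a finite point the
  extension by continuity can only take the value of the affine map, by uniqueness of
  limits.\<close>

lemma mobile_vec_overlap:
  assumes "c \<in> \<A>" "c' \<in> \<A>" "x \<in> chart_dom c" "x \<in> chart_dom c'" "induces_overlap c c' A b"
  shows "mobile_vec c' y x = A *v mobile_vec c y x + b"
proof -
  let ?v = "mobile_vec c y x"
  have tp: "((\<lambda>v. tpoint {} (g v)) \<longlongrightarrow> tpoint {} l) F" if "(g \<longlongrightarrow> l) F"
    for g :: "real ^ 'n \<Rightarrow> real ^ 'n" and l F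
    using that by (intro vec_tendstoI) (simp add: tendsto_vec_nth)
  have "y x \<in> chart_dom c \<inter> chart_dom c'"
    using mobile_point(1)[OF assms(1,3)] mobile_point(1)[OF assms(2,4)] by simp
  then have "affine_extension_at A b (chart_map c (y x)) (chart_map c' (y x))"
    using assms(5) unfolding induces_overlap_def by blast
  then have "affine_extension_at A b (tpoint {} ?v) (tpoint {} (mobile_vec c' y x))"
    by (simp only: mobile_point(2)[OF assms(1,3)] mobile_point(2)[OF assms(2,4)])
  \<comment> \<open>Continuity of \<open>tpoint {}\<close> at \<open>?v\<close>, read as a
    comparison of filters, turns the extension into an ordinary limit at \<open>?v\<close>.\<close>
  moreover have "nhds ?v \<le> filtercomap (tpoint {}) (nhds (tpoint {} ?v))"
    using tp[OF filterlim_ident] by (simp add: filterlim_iff_le_filtercomap)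
  ultimately have "((\<lambda>v. tpoint {} (A *v v + b)) \<longlongrightarrow> tpoint {} (mobile_vec c' y x)) (nhds ?v)"
    unfolding affine_extension_at_def by (rule filterlim_mono[OF _ order_refl])
  moreover have "((\<lambda>v. tpoint {} (A *v v + b)) \<longlongrightarrow> tpoint {} (A *v ?v + b)) (nhds ?v)"
    by (rule tp, rule tendsto_add[OF _ tendsto_const],
        rule bounded_linear.tendsto[OF matrix_vector_mul_bounded_linear filterlim_ident])
  ultimately have "tpoint {} (mobile_vec c' y x) $ i = tpoint {} (A *v ?v + b) $ i" for i
    by (intro tendsto_unique[OF nhds_neq_bot tendsto_vec_nth tendsto_vec_nth])
  then show ?thesis by (simp add: vec_eq_iff)
qed

end


section \<open>Cochains\<close>

definition edge_path :: "real \<Rightarrow> nat \<Rightarrow> real" where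
  "edge_path t = (\<lambda>i. if i = 0 then 1 - t else if i = 1 then t else 0)"

lemma edge_path_endpoints [simp]:
  "edge_path 0 = simplex_vertex 0" "edge_path 1 = simplex_vertex 1"
  by (auto simp: edge_path_def simplex_vertex_def)

lemma edge_path_in_simplex: "t \<in> {0..1} \<Longrightarrow> edge_path t \<in> standard_simplex 1"
  by (auto simp: edge_path_def standard_simplex_def)

lemma edge_path_in_open_face: "t \<in> {0<..<1} \<Longrightarrow> edge_path t \<in> open_face 1 {0, 1}"
  using edge_path_in_simplex[of t] by (auto simp: open_face_def edge_path_def split: if_splits)

lemma pathin_edge_path:
  "pathin (subtopology (powertop_real UNIV) (standard_simplex 1)) edge_path"
proof -
  have "continuous_map (top_of_set {0..1}) euclideanreal (\<lambda>t. edge_path t i)" for i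
    by (cases "i = 0"; cases "i = 1") (auto simp: edge_path_def intro: continuous_intros)
  then show ?thesis
    using edge_path_in_simplex
    by (auto simp: pathin_def continuous_map_in_subtopology continuous_map_componentwise_UNIV)
qed

lemma simplex_vertex_in_simplex: "k \<le> r \<Longrightarrow> simplex_vertex k \<in> standard_simplex r"
  using basis_in_standard_simplex[of k r] by (simp add: simplex_vertex_def)

lemma simplical_face_vertex:
  "simplical_face k (simplex_vertex i) = simplex_vertex (if i < k then i else Suc i)"
  by (auto simp: simplical_face_def simplex_vertex_def fun_eq_iff)

lemma singular_face_apply:
  "t \<in> standard_simplex r \<Longrightarrow> singular_face (Suc r) k \<sigma> t = \<sigma> (simplical_face k t)"
  by (simp add: singular_face_def)

lemma singular_face_vertex:
  "i \<le> r \<Longrightarrow> singular_face (Suc r) k \<sigma> (simplex_vertex i)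
    = \<sigma> (simplex_vertex (if i < k then i else Suc i))"
  by (simp only: singular_face_apply simplex_vertex_in_simplex simplical_face_vertex)

lemma simplical_face_in_simplex:
  "k \<le> Suc r \<Longrightarrow> t \<in> standard_simplex r \<Longrightarrow> simplical_face k t \<in> standard_simplex (Suc r)"
  using simplical_face_in_standard_simplex[of "Suc r" k t] by simp

text \<open>The face map inserts a zero at position \<open>k\<close>, so it shifts supports past
  \<open>k\<close> and sends points of one open face into one open face. The stratum condition on
  simplices is thereby inherited by their faces.\<close>

lemma simplical_face_open_face:
  assumes k: "k \<le> Suc r" and t: "t \<in> open_face r K"
  shows "simplical_face k t \<in> open_face (Suc r) ((\<lambda>i. if i < k then i else Suc i) ` K)"
proof -
  have tK: "t \<in> standard_simplex r" "K = {i. t i \<noteq> 0}" using t by (auto simp: open_face_def)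
  have "simplical_face k t i \<noteq> 0 \<longleftrightarrow> i \<in> (\<lambda>i. if i < k then i else Suc i) ` K" for i
  proof (cases i k rule: linorder_cases)
    case less
    then show ?thesis by (auto simp: simplical_face_def tK image_iff)
  next
    case equal
    then show ?thesis by (auto simp: simplical_face_def)
  next
    case greater
    then obtain m where "i = Suc m" "m \<ge> k" by (cases i) auto
    then show ?thesis by (auto simp: simplical_face_def tK image_iff)
  qed
  with simplical_face_in_simplex[OF k tK(1)] show ?thesis by (auto simp: open_face_def)
qed

lemma simplex_in_chart_face:
  assumes \<sigma>: "simplex_in_chart X \<A> (Suc r) \<sigma> c" and k: "k \<le> Suc r"
  shows "simplex_in_chart X \<A> r (singular_face (Suc r) k \<sigma>) c"
  unfolding simplex_in_chart_def
proof (intro conjI allI ballI)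
  show "c \<in> \<A>" using \<sigma> by (simp add: simplex_in_chart_def)
  show "singular_simplex r X (singular_face (Suc r) k \<sigma>)"
    using singular_simplex_singular_face[of "Suc r" X \<sigma> k] \<sigma> k by (simp add: simplex_in_chart_def)
  show "singular_face (Suc r) k \<sigma> ` standard_simplex r \<subseteq> chart_dom c"
    using \<sigma> simplical_face_in_simplex[OF k]
    by (auto simp: simplex_in_chart_def singular_face_apply)
  fix K s t assume st: "s \<in> open_face r K" "t \<in> open_face r K"
  then have "s \<in> standard_simplex r" "t \<in> standard_simplex r" by (auto simp: open_face_def)
  moreover have "same_stratum X \<A> (\<sigma> (simplical_face k s)) (\<sigma> (simplical_face k t))"
    using \<sigma> simplical_face_open_face[OF k st(1)] simplical_face_open_face[OF k st(2)]
    unfolding simplex_in_chart_def by blast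
  ultimately show "same_stratum X \<A> (singular_face (Suc r) k \<sigma> s) (singular_face (Suc r) k \<sigma> t)"
    by (simp add: singular_face_apply)
qed

lemma simplex_in_chart_vertex:
  assumes "simplex_in_chart X \<A> r \<sigma> c" "k \<le> r"
  shows "c \<in> \<A>" "\<sigma> (simplex_vertex k) \<in> chart_dom c"
  using assms simplex_vertex_in_simplex[OF assms(2)] by (auto simp: simplex_in_chart_def)

lemma simplex_wave_0: "simplex_wave 0 \<sigma> c = chart_wave c (\<sigma> (simplex_vertex 0))"
proof -
  have "(\<lambda>i. if i \<le> 0 then 1 / real (Suc 0) else 0) = simplex_vertex 0"
    by (auto simp: simplex_vertex_def)
  then show ?thesis by (simp add: simplex_wave_def)
qed

lemma simplex_wave_1: "simplex_wave 1 \<sigma> c = chart_wave c (\<sigma> (edge_path (1/2)))"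
proof -
  have "(\<lambda>i. if i \<le> 1 then 1 / real (Suc 1) else 0) = edge_path (1/2)"
    by (auto simp: edge_path_def fun_eq_iff)
  then show ?thesis unfolding simplex_wave_def by (rule arg_cong)
qed

lemma subspace_simplex_wave: "subspace (simplex_wave r \<sigma> c)"
  by (simp add: simplex_wave_def subspace_chart_wave)

text \<open>This is the simplicial identity for vertices of a triangle. Cochains are evaluated on
  functions, so the two sides must also agree off the simplex, where both are
  \<open>undefined\<close>.\<close>

lemma singular_face_singular_face_0:
  assumes "i \<le> j" "j \<le> 1"
  shows "singular_face (Suc 0) i (singular_face (Suc (Suc 0)) (Suc j) \<sigma>)
    = singular_face (Suc 0) j (singular_face (Suc (Suc 0)) i \<sigma>)"
proof
  fix t :: "nat \<Rightarrow> real"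
  show "singular_face (Suc 0) i (singular_face (Suc (Suc 0)) (Suc j) \<sigma>) t
    = singular_face (Suc 0) j (singular_face (Suc (Suc 0)) i \<sigma>) t"
  proof (cases "t \<in> standard_simplex 0")
    case True
    have "simplical_face (Suc j) (simplical_face i t) = simplical_face i (simplical_face j t)"
      using assms(1) by (auto simp: simplical_face_def fun_eq_iff)
    with True assms show ?thesis
      using simplical_face_in_simplex[of i 0 t] simplical_face_in_simplex[of j 0 t]
      by (simp add: singular_face_apply)
  next
    case False
    then show ?thesis by (simp add: singular_face_def)
  qed
qed

section \<open>Coboundaries in low degrees\<close>

lemma wave_coboundary_1_simplex:
  assumes "simplex_in_chart X \<A> 1 \<tau> c"
  shows "wave_coboundary X \<A> 0 f \<tau> c = f (singular_face 1 0 \<tau>) c - f (singular_face 1 1 \<tau>) c"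
  using assms by (simp add: wave_coboundary_def)

lemma wave_coboundary_2_simplex:
  assumes "simplex_in_chart X \<A> 2 \<sigma> c"
  shows "wave_coboundary X \<A> 1 f \<sigma> c
    = f (singular_face 2 0 \<sigma>) c - f (singular_face 2 1 \<sigma>) c + f (singular_face 2 2 \<sigma>) c"
  using assms by (simp add: wave_coboundary_def numeral_2_eq_2)

lemma wave_coboundary_diff:
  "wave_coboundary X \<A> r (\<lambda>\<sigma> c. f \<sigma> c - g \<sigma> c)
    = (\<lambda>\<sigma> c. wave_coboundary X \<A> r f \<sigma> c - wave_coboundary X \<A> r g \<sigma> c)"
  by (intro ext) (simp add: wave_coboundary_def scaleR_diff_right sum_subtractf)

lemma wave_coboundary_add:
  "wave_coboundary X \<A> r (\<lambda>\<sigma> c. f \<sigma> c + g \<sigma> c)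
    = (\<lambda>\<sigma> c. wave_coboundary X \<A> r f \<sigma> c + wave_coboundary X \<A> r g \<sigma> c)"
  by (intro ext) (simp add: wave_coboundary_def scaleR_add_right sum.distrib)

text \<open>Each vertex of a triangle lies on two of its edges and is counted with opposite
  signs.\<close>

lemma wave_coboundary_coboundary_0:
  "wave_coboundary X \<A> 1 (wave_coboundary X \<A> 0 f) = (\<lambda>\<sigma> c. 0)"
proof (intro ext)
  fix \<sigma> c
  show "wave_coboundary X \<A> 1 (wave_coboundary X \<A> 0 f) \<sigma> c = 0"
  proof (cases "simplex_in_chart X \<A> 2 \<sigma> c")
    case True
    have "simplex_in_chart X \<A> 1 (singular_face 2 k \<sigma>) c" if "k \<le> 2" for k
      using simplex_in_chart_face[of X \<A> 1 \<sigma> c k] True that by (simp add: numeral_2_eq_2)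
    moreover have "singular_face 1 0 (singular_face 2 1 \<sigma>) = singular_face 1 0 (singular_face 2 0 \<sigma>)"
      "singular_face 1 0 (singular_face 2 2 \<sigma>) = singular_face 1 1 (singular_face 2 0 \<sigma>)"
      "singular_face 1 1 (singular_face 2 2 \<sigma>) = singular_face 1 1 (singular_face 2 1 \<sigma>)"
      using singular_face_singular_face_0[of 0 0 \<sigma>] singular_face_singular_face_0[of 0 1 \<sigma>]
        singular_face_singular_face_0[of 1 1 \<sigma>]
      by (simp_all add: numeral_2_eq_2)
    ultimately show ?thesis
      by (simp add: wave_coboundary_2_simplex[OF True] wave_coboundary_1_simplex del: One_nat_def)
  qed (simp add: wave_coboundary_def numeral_2_eq_2)
qed

section \<open>Groups of cochains and their cosets\<close>

lemma zero_in_wave_cochains: "(\<lambda>\<sigma> c. 0) \<in> wave_cochains X \<A> r"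
  by (simp add: wave_cochains_def subspace_0 subspace_simplex_wave)

lemma diff_in_wave_cochains:
  assumes "f \<in> wave_cochains X \<A> r" "g \<in> wave_cochains X \<A> r"
  shows "(\<lambda>\<sigma> c. f \<sigma> c - g \<sigma> c) \<in> wave_cochains X \<A> r"
  unfolding wave_cochains_def
proof (intro CollectI conjI allI impI)
  show "f \<sigma> c - g \<sigma> c \<in> simplex_wave r \<sigma> c" if "simplex_in_chart X \<A> r \<sigma> c" for \<sigma> c
    using assms that by (simp add: wave_cochains_def subspace_diff[OF subspace_simplex_wave])
  show "f \<sigma> c - g \<sigma> c = 0" if "\<not> simplex_in_chart X \<A> r \<sigma> c" for \<sigma> c
    using assms that by (simp add: wave_cochains_def)
  fix \<sigma> c c' A b
  assume *: "simplex_in_chart X \<A> r \<sigma> c \<and> simplex_in_chart X \<A> r \<sigma> c' \<and> induces_overlap c c' A b"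
  have "A *v f \<sigma> c = f \<sigma> c'" "A *v g \<sigma> c = g \<sigma> c'"
    using assms * unfolding wave_cochains_def by blast+
  then show "A *v (f \<sigma> c - g \<sigma> c) = f \<sigma> c' - g \<sigma> c'"
    by (simp add: matrix_vector_mult_diff_distrib)
qed

lemma zero_in_div_cochains: "(\<lambda>\<sigma> c. 0) \<in> div_cochains X \<A>"
  by (simp add: div_cochains_def zero_in_wave_cochains wave_div_def span_zero)

lemma diff_in_div_cochains:
  assumes "f \<in> div_cochains X \<A>" "g \<in> div_cochains X \<A>"
  shows "(\<lambda>\<sigma> c. f \<sigma> c - g \<sigma> c) \<in> div_cochains X \<A>"
  using assms by (simp add: div_cochains_def diff_in_wave_cochains wave_div_def span_diff)

text \<open>The subgroup criterion for pointwise addition is all that coset arguments require; it is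
  applied to the divisorial coboundaries and to all coboundaries.\<close>

definition cochain_group :: "('a, 'n::finite) wave_cochain set \<Rightarrow> bool" where
  "cochain_group B \<longleftrightarrow> (\<lambda>\<sigma> c. 0) \<in> B \<and> (\<forall>f\<in>B. \<forall>g\<in>B. (\<lambda>\<sigma> c. f \<sigma> c - g \<sigma> c) \<in> B)"

lemma cochain_group_diff:
  "cochain_group B \<Longrightarrow> f \<in> B \<Longrightarrow> g \<in> B \<Longrightarrow> (\<lambda>\<sigma> c. f \<sigma> c - g \<sigma> c) \<in> B"
  by (simp add: cochain_group_def)

lemma cochain_group_coboundary_image:
  assumes "cochain_group C"
  shows "cochain_group (wave_coboundary X \<A> r ` C)"
  unfolding cochain_group_def
proof (intro conjI ballI)
  have "wave_coboundary X \<A> r (\<lambda>\<sigma> c. 0) = (\<lambda>\<sigma> c. 0)"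
    by (intro ext) (simp add: wave_coboundary_def)
  moreover have "(\<lambda>\<sigma> c. 0) \<in> C" using assms by (simp add: cochain_group_def)
  ultimately show "(\<lambda>\<sigma> c. 0) \<in> wave_coboundary X \<A> r ` C" by (rule image_eqI[OF sym])
  fix f g assume "f \<in> wave_coboundary X \<A> r ` C" "g \<in> wave_coboundary X \<A> r ` C"
  then obtain f' g' where eq: "f = wave_coboundary X \<A> r f'" "g = wave_coboundary X \<A> r g'"
    and "f' \<in> C" "g' \<in> C" by blast
  then have "(\<lambda>\<sigma> c. f' \<sigma> c - g' \<sigma> c) \<in> C" by (intro cochain_group_diff[OF assms])
  then have "wave_coboundary X \<A> r (\<lambda>\<sigma> c. f' \<sigma> c - g' \<sigma> c) \<in> wave_coboundary X \<A> r ` C"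
    by (rule imageI)
  then show "(\<lambda>\<sigma> c. f \<sigma> c - g \<sigma> c) \<in> wave_coboundary X \<A> r ` C"
    by (simp only: wave_coboundary_diff eq)
qed

lemma cochain_group_div_coboundaries: "cochain_group (div_coboundaries X \<A>)"
  unfolding div_coboundaries_def
  by (intro cochain_group_coboundary_image)
     (simp add: cochain_group_def zero_in_div_cochains diff_in_div_cochains)

lemma wave_coboundaries_1: "wave_coboundaries X \<A> 1 = wave_coboundary X \<A> 0 ` wave_cochains X \<A> 0"
  by (simp add: wave_coboundaries_def)

lemma cochain_group_wave_coboundaries: "cochain_group (wave_coboundaries X \<A> 1)"
  unfolding wave_coboundaries_1
  by (intro cochain_group_coboundary_image)
     (simp add: cochain_group_def zero_in_wave_cochains diff_in_wave_cochains)

lemma add_in_cochain_coset: "b \<in> B \<Longrightarrow> (\<lambda>\<sigma> c. f \<sigma> c + b \<sigma> c) \<in> cochain_coset f B"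
  by (auto simp: cochain_coset_def)

lemma cochain_coset_self:
  assumes "cochain_group B"
  shows "f \<in> cochain_coset f B"
  using add_in_cochain_coset[of "\<lambda>\<sigma> c. 0" B f] assms by (simp add: cochain_group_def)

lemma cochain_coset_subset:
  assumes B: "cochain_group B" and b: "(\<lambda>\<sigma> c. g \<sigma> c - f \<sigma> c) \<in> B"
  shows "cochain_coset f B \<subseteq> cochain_coset g B"
proof
  fix h assume "h \<in> cochain_coset f B"
  then obtain d where d: "d \<in> B" "h = (\<lambda>\<sigma> c. f \<sigma> c + d \<sigma> c)"
    by (auto simp: cochain_coset_def)
  have "(\<lambda>\<sigma> c. g \<sigma> c + (d \<sigma> c - (g \<sigma> c - f \<sigma> c))) \<in> cochain_coset g B"
    by (intro add_in_cochain_coset cochain_group_diff[OF B d(1) b])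
  then show "h \<in> cochain_coset g B" by (simp add: d(2) add.commute)
qed

lemma cochain_coset_eqI:
  assumes B: "cochain_group B" and b: "(\<lambda>\<sigma> c. g \<sigma> c - f \<sigma> c) \<in> B"
  shows "cochain_coset f B = cochain_coset g B"
proof
  show "cochain_coset f B \<subseteq> cochain_coset g B" by (rule cochain_coset_subset[OF B b])
  have "(\<lambda>\<sigma> c. 0 - (g \<sigma> c - f \<sigma> c)) \<in> B"
    using B by (intro cochain_group_diff[OF B _ b]) (simp add: cochain_group_def)
  then show "cochain_coset g B \<subseteq> cochain_coset f B"
    by (intro cochain_coset_subset[OF B]) simp
qed

section \<open>The eigenwave as a closed wave cochain\<close>

context mobile_choice_space
begin

lemma eigenwave_cochain_simplex:
  "simplex_in_chart X \<A> 1 \<tau> c \<Longrightarrow> eigenwave_cochain X \<A> y \<tau> c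
    = mobile_vec c y (\<tau> (simplex_vertex 1)) - mobile_vec c y (\<tau> (simplex_vertex 0))"
  by (simp add: eigenwave_cochain_def mobile_vec_def)

lemma eigenwave_cochain_in_simplex_wave:
  assumes W: "wave_inclusions X \<A>" and \<tau>: "simplex_in_chart X \<A> 1 \<tau> c"
  shows "eigenwave_cochain X \<A> y \<tau> c \<in> simplex_wave 1 \<tau> c"
proof -
  define \<gamma> where "\<gamma> = \<tau> \<circ> edge_path"
  have c: "c \<in> \<A>" using \<tau> by (simp add: simplex_in_chart_def)
  have "continuous_map (subtopology (powertop_real UNIV) (standard_simplex 1)) X \<tau>"
    and im: "\<tau> ` standard_simplex 1 \<subseteq> chart_dom c"
    using \<tau> by (auto simp: simplex_in_chart_def singular_simplex_def)
  then have "continuous_map (subtopology (powertop_real UNIV) (standard_simplex 1))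
      (subtopology X (chart_dom c)) \<tau>"
    by (auto simp: continuous_map_in_subtopology)
  then have \<gamma>: "pathin (subtopology X (chart_dom c)) \<gamma>"
    using pathin_edge_path unfolding pathin_def \<gamma>_def by (rule continuous_map_compose[rotated])
  have stratum: "same_stratum X \<A> (\<gamma> s) (\<gamma> t)" if "s \<in> {0<..<1}" "t \<in> {0<..<1}" for s t
    using \<tau> edge_path_in_open_face[OF that(1)] edge_path_in_open_face[OF that(2)]
    by (auto simp: simplex_in_chart_def \<gamma>_def)
  have "chart_wave c (\<gamma> t) \<subseteq> chart_wave c (\<gamma> (1/2))" if t: "t \<in> {0<..<1}" for t
  proof -
    \<comment> \<open>\<open>a\<close> runs from \<open>t\<close> to the parameter
      \<open>1/2\<close> of the barycentre without meeting the ends, so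
      \<open>\<gamma> \<circ> a\<close> stays in one stratum and \<open>wave_inclusions\<close>
      applies to it.\<close>
    define a where "a = (\<lambda>u::real. (1 - u) * t + u * (1/2))"
    have a: "a u \<in> {0<..<1}" if "u \<in> {0..1}" for u
    proof -
      have "(1 - u) *\<^sub>R t + u *\<^sub>R (1/2) \<in> {0<..<1::real}"
        by (rule convexD) (use t that in auto)
      then show ?thesis by (simp add: a_def)
    qed
    have "continuous_map (top_of_set {0..1}) (top_of_set {0..1}) a"
      unfolding continuous_map_in_subtopology
    proof
      show "continuous_map (top_of_set {0..1}) euclideanreal a"
        by (auto simp: a_def intro!: continuous_intros)
      show "a \<in> topspace (top_of_set {0..1}) \<rightarrow> {0..1}" using a by fastforce
    qed
    then have "pathin (subtopology X (chart_dom c)) (\<gamma> \<circ> a)"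
      using \<gamma> unfolding pathin_def by (rule continuous_map_compose)
    moreover have "\<forall>s\<in>{0<..1}. \<forall>t\<in>{0<..1}. same_stratum X \<A> ((\<gamma> \<circ> a) s) ((\<gamma> \<circ> a) t)"
      using stratum a by simp
    ultimately have "chart_wave c ((\<gamma> \<circ> a) 0) \<subseteq> chart_wave c ((\<gamma> \<circ> a) 1)"
      using W c unfolding wave_inclusions_def by blast
    then show ?thesis by (simp add: a_def)
  qed
  then have "mobile_vec c y (\<gamma> 1) - mobile_vec c y (\<gamma> 0) \<in> chart_wave c (\<gamma> (1/2))"
    by (rule mobile_vec_diff_in_wave[OF c \<gamma> subspace_chart_wave])
  then show ?thesis
    by (simp only: eigenwave_cochain_simplex[OF \<tau>] simplex_wave_1)
       (simp add: \<gamma>_def)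
qed

text \<open>The overlap maps act affinely on mobile points; the translation \<open>b\<close> cancels
  in the difference of the two ends and leaves the linear part.\<close>

lemma eigenwave_cochain_in_wave_cochains:
  assumes "wave_inclusions X \<A>"
  shows "eigenwave_cochain X \<A> y \<in> wave_cochains X \<A> 1"
proof -
  have "A *v eigenwave_cochain X \<A> y \<tau> c = eigenwave_cochain X \<A> y \<tau> c'"
    if \<tau>: "simplex_in_chart X \<A> 1 \<tau> c" "simplex_in_chart X \<A> 1 \<tau> c'"
      and A: "induces_overlap c c' A b" for \<tau> c c' A b
  proof -
    have "mobile_vec c' y (\<tau> (simplex_vertex k)) = A *v mobile_vec c y (\<tau> (simplex_vertex k)) + b"
      if "k \<le> 1" for k
      using simplex_in_chart_vertex[OF \<tau>(1) that] simplex_in_chart_vertex[OF \<tau>(2) that] A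
      by (intro mobile_vec_overlap)
    then show ?thesis
      by (simp add: eigenwave_cochain_simplex[OF \<tau>(1)] eigenwave_cochain_simplex[OF \<tau>(2)]
          matrix_vector_mult_diff_distrib)
  qed
  then show ?thesis
    unfolding wave_cochains_def
    using eigenwave_cochain_in_simplex_wave[OF assms]
    by (auto simp: eigenwave_cochain_def)
qed

text \<open>With \<open>v0\<close>, \<open>v1\<close>, \<open>v2\<close> the mobile vectors at the
  vertices, the three edges contribute \<open>(v2 - v1) - (v2 - v0) + (v1 - v0)\<close>.\<close>

lemma wave_coboundary_eigenwave_cochain:
  "wave_coboundary X \<A> 1 (eigenwave_cochain X \<A> y) = (\<lambda>\<sigma> c. 0)"
proof (intro ext)
  fix \<sigma> c
  show "wave_coboundary X \<A> 1 (eigenwave_cochain X \<A> y) \<sigma> c = 0"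
  proof (cases "simplex_in_chart X \<A> 2 \<sigma> c")
    case True
    have face: "simplex_in_chart X \<A> 1 (singular_face 2 k \<sigma>) c" if "k \<le> 2" for k
      using simplex_in_chart_face[of X \<A> 1 \<sigma> c k] True that by (simp add: numeral_2_eq_2)
    have "singular_face 2 k \<sigma> (simplex_vertex i) = \<sigma> (simplex_vertex (if i < k then i else Suc i))"
      if "i \<le> 1" for i k
      using singular_face_vertex[OF that, of k \<sigma>] by (simp add: numeral_2_eq_2)
    then show ?thesis
      by (simp add: wave_coboundary_2_simplex[OF True] eigenwave_cochain_simplex[OF face]
          numeral_2_eq_2[symmetric] flip: One_nat_def)
  qed (simp add: wave_coboundary_def numeral_2_eq_2)
qed

end

lemma eigenwave_cochain_change_choice:
  assumes "mobile_choice_space X \<A> y" "mobile_choice_space X \<A> y'"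
  shows "(\<lambda>\<tau> c. eigenwave_cochain X \<A> y' \<tau> c - eigenwave_cochain X \<A> y \<tau> c)
    \<in> div_coboundaries X \<A>"
proof -
  interpret y: mobile_choice_space X \<A> y by fact
  interpret y': mobile_choice_space X \<A> y' by fact
  \<comment> \<open>\<open>f\<close> is the displacement from the old mobile point to the new one.
    Both project to the same point along divisorial directions, so \<open>f\<close> is
    divisorial.\<close>
  define f where "f = (\<lambda>\<sigma> c. if simplex_in_chart X \<A> 0 \<sigma> c
    then mobile_vec c y' (\<sigma> (simplex_vertex 0)) - mobile_vec c y (\<sigma> (simplex_vertex 0)) else 0)"
  have div: "f \<sigma> c \<in> wave_div (chart_map c (\<sigma> (simplex_vertex 0)))"
    if \<sigma>: "simplex_in_chart X \<A> 0 \<sigma> c" for \<sigma> c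
  proof -
    let ?x = "\<sigma> (simplex_vertex 0)"
    have x: "c \<in> \<A>" "?x \<in> chart_dom c"
      using simplex_in_chart_vertex[OF \<sigma>] by auto
    have "(mobile_vec c y' ?x - realvec (chart_map c ?x))
        - (mobile_vec c y ?x - realvec (chart_map c ?x)) \<in> coord_space (sed (chart_map c ?x))"
      by (rule subspace_diff[OF subspace_coord_space y'.mobile_point(4)[OF x] y.mobile_point(4)[OF x]])
    with \<sigma> show ?thesis by (simp add: f_def coord_space_eq_wave_div)
  qed
  have "f \<in> wave_cochains X \<A> 0"
    unfolding wave_cochains_def
  proof (intro CollectI conjI allI impI)
    show "f \<sigma> c \<in> simplex_wave 0 \<sigma> c" if \<sigma>: "simplex_in_chart X \<A> 0 \<sigma> c" for \<sigma> c
      using div[OF \<sigma>] y.wave_div_subset_chart_wave simplex_in_chart_vertex[OF \<sigma>]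
      unfolding simplex_wave_0 by blast
    show "f \<sigma> c = 0" if "\<not> simplex_in_chart X \<A> 0 \<sigma> c" for \<sigma> c
      using that by (simp add: f_def)
    fix \<sigma> c c' A b
    assume *: "simplex_in_chart X \<A> 0 \<sigma> c \<and> simplex_in_chart X \<A> 0 \<sigma> c' \<and> induces_overlap c c' A b"
    then have x: "c \<in> \<A>" "c' \<in> \<A>" "\<sigma> (simplex_vertex 0) \<in> chart_dom c"
        "\<sigma> (simplex_vertex 0) \<in> chart_dom c'" "induces_overlap c c' A b"
      using simplex_in_chart_vertex by blast+
    show "A *v f \<sigma> c = f \<sigma> c'"
      using * y.mobile_vec_overlap[OF x] y'.mobile_vec_overlap[OF x]
      by (simp add: f_def matrix_vector_mult_diff_distrib)
  qed
  with div have "f \<in> div_cochains X \<A>" by (simp add: div_cochains_def)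
  moreover have "(\<lambda>\<tau> c. eigenwave_cochain X \<A> y' \<tau> c - eigenwave_cochain X \<A> y \<tau> c)
      = wave_coboundary X \<A> 0 f"
  proof (intro ext)
    fix \<tau> c
    show "eigenwave_cochain X \<A> y' \<tau> c - eigenwave_cochain X \<A> y \<tau> c = wave_coboundary X \<A> 0 f \<tau> c"
    proof (cases "simplex_in_chart X \<A> 1 \<tau> c")
      case True
      have "simplex_in_chart X \<A> 0 (singular_face 1 k \<tau>) c" if "k \<le> 1" for k
        using simplex_in_chart_face[of X \<A> 0 \<tau> c k] True that by simp
      \<comment> \<open>Face \<open>0\<close> of an edge is its final vertex and face
        \<open>1\<close> its initial one, which matches the sign in the eigenwave.\<close>
      moreover have "singular_face 1 k \<tau> (simplex_vertex 0)
          = \<tau> (simplex_vertex (if 0 < k then 0 else 1))" for k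
        using singular_face_vertex[of 0 0 k \<tau>] by simp
      ultimately show ?thesis
        by (simp add: wave_coboundary_1_simplex[OF True] f_def
            y.eigenwave_cochain_simplex[OF True] y'.eigenwave_cochain_simplex[OF True])
    qed (simp add: wave_coboundary_def eigenwave_cochain_def)
  qed
  ultimately show ?thesis by (simp add: div_coboundaries_def)
qed

text \<open>The eigenwave is a coset modulo divisorial coboundaries and a cohomology class a coset
  modulo all coboundaries. That the first determines the second is expressed by containment in
  exactly one class.\<close>

theorem proposition5p2:
  fixes X :: "'a topology" and \<A> :: "('a, 'n::finite) tchart set" and y :: "'a \<Rightarrow> 'a"
  assumes "tropical_space X \<A>" and "compact_space X"
    and "wave_inclusions X \<A>"
    and "mobile_choice X \<A> y"
  shows "eigenwave_cochain X \<A> y \<in> wave_cochains X \<A> 1 \<and>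
    (\<forall>y'. mobile_choice X \<A> y' \<longrightarrow> eigenwave X \<A> y' = eigenwave X \<A> y) \<and>
    (\<forall>\<phi>\<in>eigenwave X \<A> y. wave_coboundary X \<A> 1 \<phi> = (\<lambda>\<sigma> c. 0)) \<and>
    (\<exists>!h. h \<in> wave_cohomology X \<A> 1 \<and> eigenwave X \<A> y \<subseteq> h)"
proof (intro conjI allI impI ballI)
  interpret mobile_choice_space X \<A> y by unfold_locales fact+
  let ?e = "eigenwave_cochain X \<A> y" and ?B = "wave_coboundaries X \<A> 1"
  show e: "?e \<in> wave_cochains X \<A> 1"
    by (rule eigenwave_cochain_in_wave_cochains[OF assms(3)])
  show "eigenwave X \<A> y' = eigenwave X \<A> y" if "mobile_choice X \<A> y'" for y'
  proof -
    have "mobile_choice_space X \<A> y'" using assms(1) that by unfold_locales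
    then show ?thesis
      unfolding eigenwave_def
      using mobile_choice_space_axioms
      by (intro cochain_coset_eqI cochain_group_div_coboundaries eigenwave_cochain_change_choice)
  qed
  show "wave_coboundary X \<A> 1 \<phi> = (\<lambda>\<sigma> c. 0)" if "\<phi> \<in> eigenwave X \<A> y" for \<phi>
    using that wave_coboundary_eigenwave_cochain wave_coboundary_coboundary_0[of X \<A>]
    by (auto simp: eigenwave_def cochain_coset_def div_coboundaries_def wave_coboundary_add)
  have "?e \<in> wave_cocycles X \<A> 1"
    using e wave_coboundary_eigenwave_cochain by (simp add: wave_cocycles_def)
  then have "cochain_coset ?e ?B \<in> wave_cohomology X \<A> 1"
    unfolding wave_cohomology_def by blast
  moreover have "div_coboundaries X \<A> \<subseteq> ?B"
    unfolding wave_coboundaries_1 div_coboundaries_def by (auto simp: div_cochains_def)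
  then have "eigenwave X \<A> y \<subseteq> cochain_coset ?e ?B"
    unfolding eigenwave_def cochain_coset_def by blast
  moreover have "h = cochain_coset ?e ?B"
    if h: "h \<in> wave_cohomology X \<A> 1" "eigenwave X \<A> y \<subseteq> h" for h
  proof -
    obtain f where f: "h = cochain_coset f ?B" using h(1) by (auto simp: wave_cohomology_def)
    \<comment> \<open>Zero is a divisorial coboundary, so the eigenwave contains \<open>?e\<close>;
      two cosets of \<open>?B\<close> that share \<open>?e\<close> coincide.\<close>
    have "?e \<in> h"
      using h(2) cochain_coset_self[OF cochain_group_div_coboundaries] by (auto simp: eigenwave_def)
    then obtain b where "b \<in> ?B" "?e = (\<lambda>\<sigma> c. f \<sigma> c + b \<sigma> c)"
      unfolding f cochain_coset_def by blast
    then have "(\<lambda>\<sigma> c. ?e \<sigma> c - f \<sigma> c) \<in> ?B" by simp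
    then show ?thesis
      unfolding f by (rule cochain_coset_eqI[OF cochain_group_wave_coboundaries])
  qed
  ultimately show "\<exists>!h. h \<in> wave_cohomology X \<A> 1 \<and> eigenwave X \<A> y \<subseteq> h" by blast
qed

end
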